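(* Let $\Omega\subset\mathbb{R}^d$ be a bounded domain satisfying a uniform exterior ball condition of radius $r>0$, let $p\in[1,+\infty]$, and let $f^+\ge 0$ be a finite measure on $\Omega$, absolutely continuous with respect to Lebesgue measure. If $f^+\in L^p(\Omega)$, then the transport density $\sigma$ between $f^+$ and $(P_{\partial\Omega})_\# f^+$ is in $L^p(\Omega)$, and $$\|\sigma\|_{L^p(\Omega)}\le C\,\|f^+\|_{L^p(\Omega)},$$ where the constant $C$ only depends on $d$, $r$ and $L=\operatorname{diam}(\Omega)$.
   Context: Exterior ball condition: a bounded domain $\Omega\subset\mathbb{R}^d$ satisfies a (uniform) exterior ball condition of radius $r>0$ if for every $x\in\partial\Omega$ there exists $y\in\mathbb{R}^d\setminus\Omega$ such that $|x-y|=r$ and $B(y,r)\cap\Omega=\emptyset$, where $B(y,r)$ is the open ball. Projection: $P_{\partial\Omega}(x)=\operatorname{argmin}\{|x-y|:y\in\partial\Omega\}$; it is single-valued for Lebesgue-a.e. $x$, so $(P_{\partial\Omega})_\# f^+$ (the image measure) is well defined when $f^+$ is absolutely continuous. Transport density: for finite positive compactly supported Borel measures $\mu,\nu$ on $\mathbb{R}^d$ of equal mass with $\mu$ absolutely continuous, let $\Pi(\mu,\nu)$ be the set of positive measures on $\mathbb{R}^d\times\mathbb{R}^d$ with marginals $\mu,\nu$, and let $\gamma$ be any minimizer of $\int |x-y|\,d\gamma$ over $\Pi(\mu,\nu)$. The transport density from $\mu$ to $\nu$ is the measure $$\sigma(A)=\int \mathcal{H}^1(A\cap[x,y])\,d\gamma(x,y)\quad\text{for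 every Borel set }A,$$ where $[x,y]$ is the segment from $x$ to $y$ and $\mathcal{H}^1$ is the one-dimensional Hausdorff measure. It is known that $\sigma$ does not depend on the choice of the optimal $\gamma$ and that it is absolutely continuous with respect to Lebesgue measure. Absolutely continuous measures are identified with their densities. *)

theory Defs
  imports "HOL-Analysis.Analysis" "HOL-Probability.Essential_Supremum"
begin

definition bounded_domain :: "'a::euclidean_space set \<Rightarrow> bool" where
  "bounded_domain \<Omega> \<longleftrightarrow> open \<Omega> \<and> connected \<Omega> \<and> bounded \<Omega> \<and> \<Omega> \<noteq> {}"

definition exterior_ball_condition :: "real \<Rightarrow> 'a::euclidean_space set \<Rightarrow> bool" where
  "exterior_ball_condition r \<Omega> \<longleftrightarrow>
     (\<forall>x\<in>frontier \<Omega>. \<exists>y. y \<notin> \<Omega> \<and> dist x y = r \<and> ball y r \<inter> \<Omega> = {})"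


section \<open>One-dimensional Hausdorff measure\<close>

text \<open>The covers have to consist of bounded sets because \<^const>\<open>diameter\<close> is real-valued
  and unspecified on unbounded sets. A cover may contain empty sets (of diameter 0), so finite
  covers are included. In dimension one the usual normalising constant is 1.\<close>

definition hausdorff1_pre :: "real \<Rightarrow> 'a::metric_space set \<Rightarrow> ennreal" where
  "hausdorff1_pre \<delta> A =
     (INF U \<in> {U :: nat \<Rightarrow> 'a set. A \<subseteq> (\<Union>i. U i) \<and> (\<forall>i. bounded (U i) \<and> diameter (U i) \<le> \<delta>)}.
        \<Sum>i. ennreal (diameter (U i)))"

definition hausdorff1 :: "'a::metric_space set \<Rightarrow> ennreal" where
  "hausdorff1 A = (SUP \<delta> \<in> {0<..}. hausdorff1_pre \<delta> A)"


section \<open>Optimal transport plans and the transport density\<close>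

definition transport_plans ::
  "'a::euclidean_space measure \<Rightarrow> 'a measure \<Rightarrow> ('a \<times> 'a) measure set" where
  "transport_plans \<mu> \<nu> =
     {\<gamma>. sets \<gamma> = sets borel \<and> distr \<gamma> borel fst = \<mu> \<and> distr \<gamma> borel snd = \<nu>}"

definition transport_cost :: "('a::euclidean_space \<times> 'a) measure \<Rightarrow> ennreal" where
  "transport_cost \<gamma> = (\<integral>\<^sup>+ (x, y). ennreal (dist x y) \<partial>\<gamma>)"

definition optimal_plan ::
  "'a::euclidean_space measure \<Rightarrow> 'a measure \<Rightarrow> ('a \<times> 'a) measure \<Rightarrow> bool" where
  "optimal_plan \<mu> \<nu> \<gamma> \<longleftrightarrow>
     \<gamma> \<in> transport_plans \<mu> \<nu> \<and> (\<forall>\<gamma>'\<in>transport_plans \<mu> \<nu>. transport_cost \<gamma> \<le> transport_cost \<gamma>')"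

definition is_transport_density ::
  "'a::euclidean_space measure \<Rightarrow> 'a measure \<Rightarrow> 'a measure \<Rightarrow> bool" where
  "is_transport_density \<mu> \<nu> \<sigma> \<longleftrightarrow>
     sets \<sigma> = sets borel \<and>
     (\<exists>\<gamma>. optimal_plan \<mu> \<nu> \<gamma> \<and>
        (\<forall>A\<in>sets borel. emeasure \<sigma> A = (\<integral>\<^sup>+ (x, y). hausdorff1 (A \<inter> closed_segment x y) \<partial>\<gamma>)))"

text \<open>Meaningful for finite, compactly supported Borel measures \<open>\<mu>\<close>, \<open>\<nu>\<close> of equal mass with
  \<open>\<mu>\<close> absolutely continuous: then an optimal plan exists and all of them give the same \<open>\<sigma>\<close>.\<close>

definition transport_density ::
  "'a::euclidean_space measure \<Rightarrow> 'a measure \<Rightarrow> 'a measure" where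
  "transport_density \<mu> \<nu> = (THE \<sigma>. is_transport_density \<mu> \<nu> \<sigma>)"


section \<open>The image measure under the projection onto the boundary\<close>

text \<open>\<^const>\<open>closest_point\<close> chooses an arbitrary minimiser at the points where the projection
  is multivalued. These form a Lebesgue null set, so for absolutely continuous \<open>\<mu>\<close> the image
  measure does not depend on the choice. As the choice need not be Borel measurable on that null
  set, the image is taken of the completion of \<open>\<mu>\<close>; the result is again a Borel measure.\<close>

definition boundary_projection_image ::
  "'a::euclidean_space set \<Rightarrow> 'a measure \<Rightarrow> 'a measure" where
  "boundary_projection_image \<Omega> \<mu> = distr (completion \<mu>) borel (closest_point (frontier \<Omega>))"


section \<open>The Lebesgue norm of a measure\<close>

text \<open>Used for \<open>a > 0\<close> only.\<close>

definition ennreal_powr :: "ennreal \<Rightarrow> real \<Rightarrow> ennreal" where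
  "ennreal_powr x a = (if x = \<infinity> then \<infinity> else ennreal (enn2real x powr a))"

definition Lp_norm_fun :: "ennreal \<Rightarrow> 'a::euclidean_space set \<Rightarrow> ('a \<Rightarrow> ennreal) \<Rightarrow> ennreal" where
  "Lp_norm_fun p \<Omega> g =
     (if p = \<infinity> then esssup (restrict_space lborel \<Omega>) g
      else ennreal_powr (\<integral>\<^sup>+ x\<in>\<Omega>. ennreal_powr (g x) (enn2real p) \<partial>lborel) (1 / enn2real p))"

text \<open>Absolutely continuous measures are identified with their Lebesgue densities. For a measure
  without a density \<^const>\<open>RN_deriv\<close> is 0, so \<open>Lp_norm\<close> is only used together with absolute
  continuity, see \<open>in_Lp\<close> below.\<close>

definition Lp_norm :: "ennreal \<Rightarrow> 'a::euclidean_space set \<Rightarrow> 'a measure \<Rightarrow> ennreal" where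
  "Lp_norm p \<Omega> \<mu> = Lp_norm_fun p \<Omega> (RN_deriv lborel \<mu>)"

definition ac_measure_on :: "'a::euclidean_space set \<Rightarrow> 'a measure \<Rightarrow> bool" where
  "ac_measure_on \<Omega> \<mu> \<longleftrightarrow>
     sets \<mu> = sets borel \<and> finite_measure \<mu> \<and> absolutely_continuous lborel \<mu> \<and> emeasure \<mu> (- \<Omega>) = 0"

definition in_Lp :: "ennreal \<Rightarrow> 'a::euclidean_space set \<Rightarrow> 'a measure \<Rightarrow> bool" where
  "in_Lp p \<Omega> \<mu> \<longleftrightarrow> ac_measure_on \<Omega> \<mu> \<and> Lp_norm p \<Omega> \<mu> < \<infinity>"

end

theory Submission
  imports Defs
begin

text \<open>
  Write \<open>F\<close> for the boundary of \<open>\<Omega>\<close>, \<open>d x\<close> for the distance from \<open>x\<close> to \<open>F\<close>, \<open>P x\<close> for a nearest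
  point of \<open>F\<close>, and \<open>u x\<close> for the unit vector pointing from \<open>x\<close> to \<open>P x\<close>.

  The transport problem is explicit. The nearest point is unique outside a Lebesgue null set
  (\<open>multi_nearest_null\<close>). Every plan onto a measure carried by \<open>F\<close> costs at least \<open>\<integral> d\<close>, and equality
  forces almost all mass at \<open>x\<close> to go to \<open>P x\<close>; so the plan induced by \<open>P\<close> is the only optimal one
  (\<open>optimal_plan_to_projection_iff\<close>). Since the Hausdorff measure of a piece of a segment is its
  arc length, the transport density of \<open>f\<close> is the image of the measure \<open>f(dx) ds\<close>, restricted to
  \<open>0 < s < d x\<close>, under the flow \<open>(x, s) \<mapsto> x + s u x\<close> (\<open>transport_density_eq_ray_transport\<close>).
  Parametrising the rays by arc length, rather than proportionally to their length, avoids the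
  degeneration of the Jacobian at the end of the rays and gives a bound that is uniform in \<open>p\<close>.

  The exterior ball condition enters only through the flow at a fixed time \<open>s\<close>: this map expands
  distances up to a constant, that is, \<open>dist x x' \<le> M * dist z z'\<close> for the images \<open>z\<close>, \<open>z'\<close> of
  \<open>x\<close>, \<open>x'\<close>, where \<open>M\<close> depends on \<open>r\<close> and the diameter (\<open>normal_flow_expansive\<close>). Indeed, \<open>z\<close> is an
  interior point of the segment from \<open>x\<close> to the centre of the exterior ball at \<open>P x\<close>. The distances to
  the two ends of this segment squeeze the distance to the set of all such centres between two
  paraboloids that touch at \<open>z\<close>, so that its gradient, which is \<open>- u x\<close> at \<open>z\<close>, depends on \<open>z\<close> in a
  Lipschitz way. An expansive map pulls a set of volume \<open>v\<close> back to a set of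
  volume at most \<open>K v\<close>, by covering with small cubes (\<open>emeasure_le_if_expansive\<close>). Integrating
  over \<open>s\<close>, the flow takes Lebesgue measure to a measure of density at most \<open>B\<close>.

  What remains is interpolation: a positive operator that multiplies mass by at most \<open>B\<close>
  and sends the constant \<open>1\<close> to a function bounded by \<open>B\<close> has norm at most \<open>B\<close> on every \<open>L\<^sup>p\<close>
  (\<open>Lp_norm_push_le\<close>). For finite \<open>p\<close> this comes from testing the density of the image against its own
  power \<open>p - 1\<close>, truncated, and absorbing one term of Young's inequality.
\<close>


section \<open>Expansion along normals under an exterior ball condition\<close>

text \<open>The distance from a point has Hessian at most \<open>1 / \<rho>\<close> at distance \<open>\<rho>\<close>, and the resulting
  quadratic bound is global: completing the square turns the claim into
  \<open>\<rho>\<^sup>2 + 2 \<rho> q \<le> (\<rho> + q)\<^sup>2\<close>.\<close>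

lemma norm_perturb_le:
  fixes n v :: "'a::real_inner"
  assumes "norm n = 1" "\<rho> > 0"
  shows "norm (\<rho> *\<^sub>R n + v) \<le> \<rho> + n \<bullet> v + (norm v)\<^sup>2 / (2 * \<rho>)"
proof -
  define q where "q = n \<bullet> v + (norm v)\<^sup>2 / (2 * \<rho>)"
  have nn: "n \<bullet> n = 1" using assms(1) by (simp add: norm_eq_1)
  have eq: "(norm (\<rho> *\<^sub>R n + v))\<^sup>2 = \<rho>\<^sup>2 + 2 * \<rho> * q"
    unfolding q_def power2_norm_eq_inner using assms(2)
    by (simp add: inner_add_left inner_add_right nn inner_commute field_simps power2_eq_square)
  have "0 \<le> \<rho> * (\<rho> + 2 * q)" using zero_le_power2[of "norm (\<rho> *\<^sub>R n + v)"] unfolding eq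
    by (simp add: algebra_simps power2_eq_square)
  hence "0 \<le> \<rho> + 2 * q" using assms(2) by (simp add: zero_le_mult_iff)
  hence pos: "0 \<le> \<rho> + q" using assms(2) by linarith
  have "(norm (\<rho> *\<^sub>R n + v))\<^sup>2 \<le> (\<rho> + q)\<^sup>2"
    unfolding eq by (simp add: power2_sum)
  hence "norm (\<rho> *\<^sub>R n + v) \<le> \<rho> + q" using pos by (rule power2_le_imp_le)
  thus ?thesis by (simp add: q_def)
qed

text \<open>A quantitative form of the principle that a function touched at \<open>z\<close> from above by the distance to
  one end of a segment through \<open>z\<close>, and from below by a constant minus the distance to the other
  end, is differentiable there with Lipschitz gradient. The hypotheses say that the upper end
  \<open>z + s n\<close> of the first segment is no nearer to the lower end \<open>z' - \<rho>' n'\<close> of the second segment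
  than to its own lower end \<open>z - \<rho> n\<close>, and symmetrically. Combining both with the paraboloid bounds at an auxiliary point \<open>w\<close> makes the
  distances cancel and leaves a bound on \<open>(n' - n) \<bullet> (w - z')\<close>.\<close>

lemma interior_ray_direction_lipschitz:
  fixes z z' n n' :: "'a::real_inner"
  assumes n: "norm n = 1" "norm n' = 1" and pos: "\<rho> > 0" "\<rho>' > 0" "s > 0"
    and a: "dist (z + s *\<^sub>R n) (z' - \<rho>' *\<^sub>R n') \<ge> \<rho> + s"
    and b: "dist (z' + s *\<^sub>R n') (z - \<rho> *\<^sub>R n) \<ge> \<rho>' + s"
  shows "s * dist n n' \<le> (1 + 2 * s / \<rho>) * dist z z'"
proof (cases "n = n'")
  case True
  thus ?thesis using pos by simp
next
  case False
  define h where "h = dist z z'"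
  have three: "0 \<le> n \<bullet> (w - z') - n' \<bullet> (w - z') + (norm (w - z))\<^sup>2 / (2 * \<rho>)
       + (norm (w - z'))\<^sup>2 / (2 * s) + h\<^sup>2 / (2 * s)" for w
  proof -
    have 1: "dist w (z - \<rho> *\<^sub>R n) \<le> \<rho> + n \<bullet> (w - z) + (norm (w - z))\<^sup>2 / (2 * \<rho>)"
      using norm_perturb_le[OF n(1) pos(1), of "w - z"] by (simp add: dist_norm algebra_simps)
    have 2: "dist w (z' + s *\<^sub>R n') \<le> s - n' \<bullet> (w - z') + (norm (w - z'))\<^sup>2 / (2 * s)"
      using norm_perturb_le[OF n(2) pos(3), of "z' - w"]
      by (simp add: dist_norm norm_minus_commute algebra_simps)
    have 3: "dist z' (z + s *\<^sub>R n) \<le> s - n \<bullet> (z' - z) + h\<^sup>2 / (2 * s)"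
      using norm_perturb_le[OF n(1) pos(3), of "z - z'"]
      by (simp add: dist_norm h_def norm_minus_commute algebra_simps)
    have 4: "dist z' (z' - \<rho>' *\<^sub>R n') = \<rho>'"
      using n pos by (simp add: dist_norm)
    have "\<rho>' + s \<le> dist w (z' + s *\<^sub>R n') + dist w (z - \<rho> *\<^sub>R n)"
      using b dist_triangle3[of "z' + s *\<^sub>R n'" "z - \<rho> *\<^sub>R n" w] by linarith
    moreover have "\<rho> + s \<le> dist z' (z + s *\<^sub>R n) + \<rho>'"
      using a 4 dist_triangle3[of "z + s *\<^sub>R n" "z' - \<rho>' *\<^sub>R n'" z'] by linarith
    moreover have "n \<bullet> (w - z) - n \<bullet> (z' - z) = n \<bullet> (w - z')"
      by (simp add: algebra_simps)
    ultimately show ?thesis using 1 2 3 by linarith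
  qed
  define N where "N = dist n n'"
  have N: "N > 0" using False by (simp add: N_def)
  \<comment> \<open>Move away from \<open>z'\<close> by \<open>\<tau>\<close> in the direction in which \<open>n' - n\<close> is detected best.\<close>
  have bound: "\<tau> * N \<le> (h + \<tau>)\<^sup>2 / (2 * \<rho>) + \<tau>\<^sup>2 / (2 * s) + h\<^sup>2 / (2 * s)" if "\<tau> > 0" for \<tau>
  proof -
    define w where "w = z' + (\<tau> / N) *\<^sub>R (n' - n)"
    have w: "norm (w - z') = \<tau>" using N that by (simp add: w_def N_def dist_norm norm_minus_commute)
    have "norm (w - z) \<le> norm (w - z') + norm (z' - z)"
      by (metis dist_norm dist_triangle)
    hence "norm (w - z) \<le> h + \<tau>" using w by (simp add: h_def dist_norm norm_minus_commute)
    hence "(norm (w - z))\<^sup>2 \<le> (h + \<tau>)\<^sup>2" by (simp add: power_mono)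
    hence le: "(norm (w - z))\<^sup>2 / (2 * \<rho>) \<le> (h + \<tau>)\<^sup>2 / (2 * \<rho>)" using pos by (simp add: divide_right_mono)
    have "n' \<bullet> (w - z') - n \<bullet> (w - z') = (n' - n) \<bullet> (w - z')" by (simp add: algebra_simps)
    also have "\<dots> = (\<tau> / N) * ((n' - n) \<bullet> (n' - n))" by (simp add: w_def)
    also have "\<dots> = (\<tau> / N) * N\<^sup>2"
      by (metis N_def dist_commute dist_norm power2_norm_eq_inner)
    also have "\<dots> = \<tau> * N" using N by (simp add: power2_eq_square)
    finally show ?thesis using three[of w] le unfolding w by linarith
  qed
  show ?thesis
  proof (cases "h = 0")
    case True
    \<comment> \<open>When \<open>z = z'\<close> the right-hand side is quadratic in \<open>\<tau>\<close>; a small \<open>\<tau>\<close> gives a contradiction.\<close>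
    define c where "c = 1 / (2 * \<rho>) + 1 / (2 * s)"
    have c: "c > 0" using pos by (simp add: c_def add_pos_pos)
    have "N / (2 * c) * N \<le> (N / (2 * c))\<^sup>2 * c"
      using bound[of "N / (2 * c)"] N c unfolding True by (simp add: c_def distrib_left)
    hence False using N c by (simp add: field_simps power2_eq_square)
    thus ?thesis ..
  next
    case False
    hence h: "h > 0" by (simp add: h_def)
    have "h * (s * N) \<le> h * ((1 + 2 * s / \<rho>) * h)"
    proof -
      have "h * (s * N) = s * (h * N)" by simp
      also have "\<dots> \<le> s * ((h + h)\<^sup>2 / (2 * \<rho>) + h\<^sup>2 / (2 * s) + h\<^sup>2 / (2 * s))"
        using bound[OF h] pos by (intro mult_left_mono) auto
      also have "\<dots> = h * ((1 + 2 * s / \<rho>) * h)"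
        using pos by (simp add: field_simps power2_eq_square)
      finally show ?thesis .
    qed
    thus ?thesis using h by (simp add: N_def h_def)
  qed
qed

text \<open>A connected set that meets \<open>\<Omega>\<close> and avoids its frontier stays inside \<open>\<Omega>\<close>.\<close>

lemma ball_subset_if_no_frontier:
  fixes \<Omega> :: "'a::euclidean_space set"
  assumes "x \<in> \<Omega>" and "\<And>q. q \<in> frontier \<Omega> \<Longrightarrow> d \<le> dist x q"
  shows "ball x d \<subseteq> \<Omega>"
proof (rule ccontr)
  assume "\<not> ball x d \<subseteq> \<Omega>"
  then obtain w where w: "w \<in> ball x d" "w \<notin> \<Omega>" by blast
  hence "d > 0" by (metis ball_eq_empty empty_iff not_less)
  hence "ball x d \<inter> frontier \<Omega> \<noteq> {}"
    using w assms(1) by (intro connected_Int_frontier) (auto intro: centre_in_ball[THEN iffD2])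
  thus False using assms(2) by force
qed

lemma dist_ge_if_disjoint_balls:
  fixes x y :: "'a::euclidean_space"
  assumes "ball x d \<inter> ball y r = {}" "d > 0" "r > 0"
  shows "d + r \<le> dist x y"
proof (rule ccontr)
  assume "\<not> d + r \<le> dist x y"
  hence lt: "dist x y < d + r" by simp
  define t where "t = d / (d + r)"
  define w where "w = x + t *\<^sub>R (y - x)"
  have t: "0 < t" "t < 1" using assms by (auto simp: t_def)
  have "dist x w = t * dist x y" using t by (simp add: w_def dist_norm norm_minus_commute)
  also have "\<dots> < t * (d + r)" using lt t by simp
  also have "\<dots> = d" using assms by (simp add: t_def)
  finally have 1: "w \<in> ball x d" by simp
  have "y - w = (1 - t) *\<^sub>R (y - x)" by (simp add: w_def algebra_simps)
  hence "dist y w = (1 - t) * dist x y" using t by (simp add: dist_norm norm_minus_commute)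
  also have "\<dots> < (1 - t) * (d + r)" using lt t by simp
  also have "\<dots> = r" using assms by (simp add: t_def field_simps)
  finally have "w \<in> ball y r" by simp
  with 1 assms(1) show False by auto
qed

text \<open>The path from \<open>x\<close> through the nearest point \<open>p\<close> to the centre \<open>y\<close> of the exterior ball is as short
  as possible, hence straight.\<close>

lemma exterior_centre_on_normal:
  fixes x p y :: "'a::euclidean_space"
  assumes "d + r \<le> dist x y" "dist x p = d" "dist p y = r" "d > 0"
  shows "y = x + (d + r) *\<^sub>R sgn (p - x)"
proof -
  have "norm ((x - p) + (p - y)) = norm (x - p) + norm (p - y)"
    using assms norm_triangle_ineq[of "x - p" "p - y"] by (simp add: dist_norm)
  hence "norm (x - p) *\<^sub>R (p - y) = norm (p - y) *\<^sub>R (x - p)"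
    using norm_triangle_eq[of "x - p" "p - y"] by blast
  hence "d *\<^sub>R (p - y) = r *\<^sub>R (x - p)" using assms by (simp add: dist_norm)
  hence "(1/d) *\<^sub>R (d *\<^sub>R (p - y)) = (1/d) *\<^sub>R (r *\<^sub>R (x - p))" by simp
  hence y: "p - y = (r / d) *\<^sub>R (x - p)" using assms(4) by simp
  have sg: "sgn (p - x) = (1 / d) *\<^sub>R (p - x)"
    using assms(2) by (simp add: sgn_div_norm dist_norm norm_minus_commute divide_inverse)
  have "x + (d + r) *\<^sub>R sgn (p - x) = x + (p - x) + (r / d) *\<^sub>R (p - x)"
    unfolding sg using assms(4) by (simp add: add_divide_distrib scaleR_add_left)
  also have "\<dots> = p - (r/d) *\<^sub>R (x - p)" by (simp add: algebra_simps)
  also have "\<dots> = y" unfolding y[symmetric] by simp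
  finally show ?thesis by simp
qed

text \<open>The exterior balls are disjoint from the inscribed balls around \<open>x\<close> and \<open>x'\<close>, which supplies the
  two distance hypotheses of \<open>interior_ray_direction_lipschitz\<close> with \<open>\<rho> = d + r - s \<ge> r\<close>. The final
  constant uses \<open>x - x' = (z - z') + s (n - n')\<close>; the factor \<open>s\<close> matters, since
  the directions themselves may vary rapidly when \<open>s\<close> is small.\<close>

lemma normal_flow_expansive:
  fixes \<Omega> :: "'a::euclidean_space set"
  assumes ext: "exterior_ball_condition r \<Omega>" and r: "r > 0"
    and x: "x \<in> \<Omega>" "p \<in> frontier \<Omega>" "\<And>q. q \<in> frontier \<Omega> \<Longrightarrow> dist x p \<le> dist x q"
    and x': "x' \<in> \<Omega>" "p' \<in> frontier \<Omega>" "\<And>q. q \<in> frontier \<Omega> \<Longrightarrow> dist x' p' \<le> dist x' q"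
    and s: "0 < s" "s < dist x p" "s < dist x' p'" "s \<le> D"
  shows "dist x x' \<le> (2 + 2 * D / r) *
           dist (x + s *\<^sub>R sgn (p - x)) (x' + s *\<^sub>R sgn (p' - x'))"
proof -
  define n where "n = - sgn (p - x)"
  define n' where "n' = - sgn (p' - x')"
  define z where "z = x + s *\<^sub>R sgn (p - x)"
  define z' where "z' = x' + s *\<^sub>R sgn (p' - x')"
  define d where "d = dist x p"
  define d' where "d' = dist x' p'"
  have d: "s < d" "s < d'" using s by (auto simp: d_def d'_def)
  obtain y where y: "dist p y = r" "ball y r \<inter> \<Omega> = {}"
    using ext x(2) unfolding exterior_ball_condition_def by blast
  obtain y' where y': "dist p' y' = r" "ball y' r \<inter> \<Omega> = {}"
    using ext x'(2) unfolding exterior_ball_condition_def by blast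
  have sub: "ball x d \<subseteq> \<Omega>" "ball x' d' \<subseteq> \<Omega>"
    using ball_subset_if_no_frontier x x' by (auto simp: d_def d'_def)
  have far: "d + r \<le> dist x y" "d + r \<le> dist x y'" "d' + r \<le> dist x' y" "d' + r \<le> dist x' y'"
    using sub y y' d s r by (auto intro!: dist_ge_if_disjoint_balls)
  have yx: "y = x + (d + r) *\<^sub>R sgn (p - x)"
    by (rule exterior_centre_on_normal) (use far y d s in \<open>auto simp: d_def\<close>)
  have yx': "y' = x' + (d' + r) *\<^sub>R sgn (p' - x')"
    by (rule exterior_centre_on_normal) (use far y' d s in \<open>auto simp: d'_def\<close>)
  have xz: "x = z + s *\<^sub>R n" "x' = z' + s *\<^sub>R n'" by (auto simp: z_def z'_def n_def n'_def)
  have yz: "y = z - (d + r - s) *\<^sub>R n" "y' = z' - (d' + r - s) *\<^sub>R n'"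
    unfolding yx yx' z_def z'_def n_def n'_def by (simp_all add: algebra_simps)
  have "p \<noteq> x" "p' \<noteq> x'" using d s by (auto simp: d_def d'_def)
  hence nn: "norm n = 1" "norm n' = 1" by (auto simp: n_def n'_def norm_sgn)
  have a: "s * dist n n' \<le> (1 + 2 * s / (d + r - s)) * dist z z'"
  proof (rule interior_ray_direction_lipschitz[OF nn, where \<rho>' = "d' + r - s"])
    show "d + r - s + s \<le> dist (z + s *\<^sub>R n) (z' - (d' + r - s) *\<^sub>R n')"
      using far(2) unfolding xz[symmetric] yz[symmetric] by simp
    show "d' + r - s + s \<le> dist (z' + s *\<^sub>R n') (z - (d + r - s) *\<^sub>R n)"
      using far(3) unfolding xz[symmetric] yz[symmetric] by simp
  qed (use d r s in auto)
  have "dist x x' \<le> dist z z' + s * dist n n'"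
  proof -
    have "x - x' = (z - z') + s *\<^sub>R (n - n')" unfolding xz by (simp add: algebra_simps)
    hence "norm (x - x') \<le> norm (z - z') + norm (s *\<^sub>R (n - n'))" by (metis norm_triangle_ineq)
    thus ?thesis using s by (simp add: dist_norm)
  qed
  also have "\<dots> \<le> (2 + 2 * s / (d + r - s)) * dist z z'"
    using a by (simp add: algebra_simps)
  also have "\<dots> \<le> (2 + 2 * D / r) * dist z z'"
    using d r s by (intro mult_right_mono add_left_mono frac_le) auto
  finally show ?thesis by (simp add: z_def z'_def)
qed

section \<open>Covering by cubes: expansive maps and Hausdorff measure on segments\<close>

text \<open>Outer regularity followed by a dyadic decomposition of the open neighbourhood. The cover is indexed
  by the natural numbers, unused indices carrying a degenerate cube of side 0, so that the
  total volume is a plain series.\<close>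

lemma cube_cover:
  fixes A :: "'a::euclidean_space set"
  assumes A: "A \<in> sets borel" "bounded A" and e: "e > 0" and \<delta>: "\<delta> > 0"
  obtains c :: "nat \<Rightarrow> 'a" and l :: "nat \<Rightarrow> real" where
    "\<And>k. 0 \<le> l k" "\<And>k. l k \<le> \<delta>" "A \<subseteq> (\<Union>k. cbox (c k) (c k + l k *\<^sub>R One))"
    "(\<Sum>k. ennreal (l k ^ DIM('a))) \<le> emeasure lborel A + ennreal e"
proof -
  obtain U where U: "open U" "A \<subseteq> U" "emeasure lborel (U - A) < ennreal e"
    using outer_regular_lborel[OF A(1) e] .
  obtain R where R: "R > 0" "\<And>x. x \<in> A \<Longrightarrow> norm x \<le> R"
    using A(2) by (auto simp: bounded_pos)
  define g where "g x = (if x \<in> U then U \<inter> ball x (\<delta> / 2) else UNIV)" for x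
  have "gauge g" using U(1) \<delta> by (auto simp: gauge_def g_def)
  moreover have "A \<subseteq> cbox (- R *\<^sub>R One) (R *\<^sub>R One)"
  proof
    fix x assume "x \<in> A"
    hence "\<bar>x \<bullet> i\<bar> \<le> R" if "i \<in> Basis" for i
      using Basis_le_norm[OF that, of x] R(2)[of x] by linarith
    thus "x \<in> cbox (- R *\<^sub>R One) (R *\<^sub>R One)"
      by (force simp: mem_box abs_le_iff)
  qed
  moreover have "box (- R *\<^sub>R One) (R *\<^sub>R One) \<noteq> ({} :: 'a set)"
    using R(1) by (auto simp: box_ne_empty)
  ultimately obtain \<D> where D: "countable \<D>"
    "\<And>K. K \<in> \<D> \<Longrightarrow> interior K \<noteq> {} \<and> (\<exists>c d. K = cbox c d)"
    "pairwise (\<lambda>A B. interior A \<inter> interior B = {}) \<D>"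
    "\<And>K. K \<in> \<D> \<Longrightarrow> \<exists>x \<in> A \<inter> K. K \<subseteq> g x"
    "\<And>u v. cbox u v \<in> \<D> \<Longrightarrow> \<exists>n. \<forall>i \<in> Basis. v \<bullet> i - u \<bullet> i =
        (R *\<^sub>R One \<bullet> i - (- R *\<^sub>R One) \<bullet> i) / 2^n"
    "A \<subseteq> \<Union>\<D>"
    using covering_lemma[of A "- R *\<^sub>R One" "R *\<^sub>R One" g] by metis
  have "\<exists>c l. K = cbox c (c + l *\<^sub>R One) \<and> 0 \<le> l \<and> l \<le> \<delta> \<and> interior K \<subseteq> U \<and>
       emeasure lborel (interior K) = ennreal (l ^ DIM('a))" if K: "K \<in> \<D>" for K
  proof -
    obtain u v where uv: "K = cbox u v" using D(2)[OF K] by auto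
    obtain n where n: "\<And>i. i \<in> Basis \<Longrightarrow> v \<bullet> i - u \<bullet> i =
        (R *\<^sub>R One \<bullet> i - (- R *\<^sub>R One) \<bullet> i) / 2^n"
      using D(5)[of u v] K uv by auto
    define l where "l = (R + R) / 2 ^ n"
    have l0: "0 \<le> l" using R by (simp add: l_def)
    have v: "v = u + l *\<^sub>R One"
    proof (rule euclidean_eqI)
      fix i :: 'a assume "i \<in> Basis"
      thus "v \<bullet> i = (u + l *\<^sub>R One) \<bullet> i"
        using n[of i] by (simp add: l_def inner_add_left algebra_simps)
    qed
    obtain x where x: "x \<in> A" "x \<in> K" "K \<subseteq> g x" using D(4)[OF K] by auto
    have KU: "K \<subseteq> U" "K \<subseteq> ball x (\<delta>/2)" using x U(2) by (auto simp: g_def split: if_splits)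
    obtain i :: 'a where i: "i \<in> Basis" by (metis SOME_Basis)
    have "u \<in> K" "u + l *\<^sub>R i \<in> K"
      using l0 i unfolding uv v by (auto simp: mem_box inner_add_left inner_Basis)
    hence "dist x u < \<delta> / 2" "dist x (u + l *\<^sub>R i) < \<delta> / 2" using KU(2) by auto
    hence "dist u (u + l *\<^sub>R i) < \<delta>"
      using dist_triangle3[of u "u + l *\<^sub>R i" x] by linarith
    hence l\<delta>: "l \<le> \<delta>" using i l0 by (simp add: dist_norm)
    have "emeasure lborel (interior K) = ennreal (l ^ DIM('a))"
      unfolding uv interior_cbox v using l0
      by (subst emeasure_lborel_box) (auto simp: inner_add_left prod_constant)
    thus ?thesis using uv v l0 l\<delta> KU(1) interior_subset by blast
  qed
  then obtain c0 l0 where K: "\<And>K. K \<in> \<D> \<Longrightarrow> K = cbox (c0 K) (c0 K + l0 K *\<^sub>R One) \<and> 0 \<le> l0 K \<and>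
       l0 K \<le> \<delta> \<and> interior K \<subseteq> U \<and> emeasure lborel (interior K) = ennreal (l0 K ^ DIM('a))"
    by metis
  define I where "I = to_nat_on \<D> ` \<D>"
  have inv: "from_nat_into \<D> k \<in> \<D>" "to_nat_on \<D> (from_nat_into \<D> k) = k" if "k \<in> I" for k
    using that D(1) by (auto simp: I_def)
  have surj: "\<exists>k\<in>I. from_nat_into \<D> k = K" if "K \<in> \<D>" for K
    using that D(1) by (auto simp: I_def)
  define c where "c k = (if k \<in> I then c0 (from_nat_into \<D> k) else 0)" for k
  define l where "l k = (if k \<in> I then l0 (from_nat_into \<D> k) else 0)" for k
  define Q where "Q k = (if k \<in> I then interior (from_nat_into \<D> k) else {})" for k
  have disj: "disjoint_family Q"
    unfolding disjoint_family_on_def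
  proof (intro ballI impI)
    fix i j :: nat assume "i \<noteq> j"
    hence "from_nat_into \<D> i \<noteq> from_nat_into \<D> j" if "i \<in> I" "j \<in> I" using that inv(2) by metis
    thus "Q i \<inter> Q j = {}" using D(3) inv(1) unfolding Q_def pairwise_def by auto
  qed
  have meas: "range Q \<subseteq> sets lborel" by (auto simp: Q_def)
  have "(\<Sum>k. ennreal (l k ^ DIM('a))) = (\<Sum>k. emeasure lborel (Q k))"
    using K inv(1) by (intro suminf_cong) (auto simp: l_def Q_def)
  also have "\<dots> = emeasure lborel (\<Union>k. Q k)"
    by (rule suminf_emeasure[OF meas disj])
  also have "\<dots> \<le> emeasure lborel U"
    using K inv(1) U(1) by (intro emeasure_mono) (auto simp: Q_def split: if_splits)
  also have "\<dots> = emeasure lborel (A \<union> (U - A))" using U(2) by (simp add: Un_absorb1)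
  also have "\<dots> \<le> emeasure lborel A + emeasure lborel (U - A)"
    using A U by (intro emeasure_subadditive) auto
  also have "\<dots> \<le> emeasure lborel A + ennreal e"
    using U(3) by (intro add_left_mono) auto
  finally have total: "(\<Sum>k. ennreal (l k ^ DIM('a))) \<le> emeasure lborel A + ennreal e" .
  show thesis
  proof (rule that[of l c])
    show "0 \<le> l k" "l k \<le> \<delta>" for k using K inv(1) \<delta> by (auto simp: l_def)
    show "A \<subseteq> (\<Union>k. cbox (c k) (c k + l k *\<^sub>R One))"
    proof
      fix x assume "x \<in> A"
      then obtain K' where K': "K' \<in> \<D>" "x \<in> K'" using D(6) by auto
      then obtain k where k: "k \<in> I" "from_nat_into \<D> k = K'" using surj by blast
      hence "x \<in> cbox (c k) (c k + l k *\<^sub>R One)" using K[of K'] K' by (simp add: c_def l_def)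
      thus "x \<in> (\<Union>k. cbox (c k) (c k + l k *\<^sub>R One))" by blast
    qed
  qed (rule total)
qed

text \<open>The part of \<open>E\<close> that \<open>T\<close> sends into a cube of side \<open>l\<close> has diameter at most \<open>M * DIM('a) * l\<close>, hence
  lies in a cube of twice that side. The bound has the same order in \<open>l\<close> as the volume of
  the original cube, so it can be summed over a cover of \<open>A\<close>.\<close>

lemma emeasure_le_if_expansive:
  fixes T :: "'a::euclidean_space \<Rightarrow> 'a"
  assumes A: "A \<in> sets borel" "bounded A" and E: "T ` E \<subseteq> A"
    and M: "M > 0" "\<And>x x'. x \<in> E \<Longrightarrow> x' \<in> E \<Longrightarrow> dist x x' \<le> M * dist (T x) (T x')"
  shows "emeasure lborel E \<le> ennreal ((2 * M * DIM('a)) ^ DIM('a)) * emeasure lborel A"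
proof (cases "E \<in> sets lborel")
  case False
  thus ?thesis by (simp add: emeasure_notin_sets)
next
  case True
  define N where "N = real DIM('a)"
  define K where "K = (2 * M * N) ^ DIM('a)"
  have K: "K > 0" using M by (simp add: K_def N_def)
  have "emeasure lborel E \<le> ennreal K * emeasure lborel A + ennreal e" if e: "e > 0" for e
  proof -
    obtain c l where cl: "\<And>k. 0 \<le> (l k::real)" "A \<subseteq> (\<Union>k. cbox (c k) (c k + l k *\<^sub>R One))"
      "(\<Sum>k. ennreal (l k ^ DIM('a))) \<le> emeasure lborel A + ennreal (e / K)"
      by (rule cube_cover[OF A, of "e / K" 1]) (use e K in auto)
    define covers where "covers k C \<longleftrightarrow> C \<in> sets lborel \<and>
       {x \<in> E. T x \<in> cbox (c k) (c k + l k *\<^sub>R One)} \<subseteq> C \<and>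
       emeasure lborel C \<le> ennreal K * ennreal (l k ^ DIM('a))" for k C
    have "\<exists>C. covers k C" for k
    proof (cases "{x \<in> E. T x \<in> cbox (c k) (c k + l k *\<^sub>R One)} = {}")
      case True
      hence "covers k {}" by (simp add: covers_def)
      thus ?thesis ..
    next
      case False
      then obtain x0 where x0: "x0 \<in> E" "T x0 \<in> cbox (c k) (c k + l k *\<^sub>R One)" by blast
      define \<rho> where "\<rho> = M * (N * l k)"
      have \<rho>: "0 \<le> \<rho>" using M cl(1) by (simp add: \<rho>_def N_def)
      have small: "dist x x0 \<le> \<rho>" if x: "x \<in> E" "T x \<in> cbox (c k) (c k + l k *\<^sub>R One)" for x
      proof -
        have "dist (T x) (T x0) \<le> (\<Sum>i\<in>Basis. \<bar>(T x - T x0) \<bullet> i\<bar>)"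
          unfolding dist_norm by (rule norm_le_l1)
        also have "\<dots> \<le> (\<Sum>i\<in>(Basis::'a set). l k)"
        proof (rule sum_mono)
          fix i :: 'a assume "i \<in> Basis"
          thus "\<bar>(T x - T x0) \<bullet> i\<bar> \<le> l k" using x(2) x0(2)
            by (force simp: mem_box inner_add_left inner_diff_left abs_le_iff)
        qed
        finally have "dist (T x) (T x0) \<le> N * l k" by (simp add: N_def)
        thus ?thesis using M(2)[OF x(1) x0(1)] M(1) unfolding \<rho>_def
          by (meson mult_left_mono less_imp_le order_trans)
      qed
      define C where "C = cbox (x0 - \<rho> *\<^sub>R One) (x0 + \<rho> *\<^sub>R One)"
      have sub: "{x \<in> E. T x \<in> cbox (c k) (c k + l k *\<^sub>R One)} \<subseteq> C"
      proof
        fix x assume x: "x \<in> {x \<in> E. T x \<in> cbox (c k) (c k + l k *\<^sub>R One)}"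
        have "\<bar>(x - x0) \<bullet> i\<bar> \<le> \<rho>" if "i \<in> Basis" for i
          using Basis_le_norm[OF that, of "x - x0"] small[of x] x by (simp add: dist_norm)
        thus "x \<in> C" unfolding C_def
          by (force simp: mem_box inner_add_left inner_diff_left abs_le_iff)
      qed
      have "emeasure lborel C = ennreal ((2 * \<rho>) ^ DIM('a))"
        unfolding C_def using \<rho>
        by (subst emeasure_lborel_cbox) (auto simp: inner_add_left inner_diff_left)
      moreover have "(2 * \<rho>) ^ DIM('a) = K * l k ^ DIM('a)"
        by (simp add: \<rho>_def K_def power_mult_distrib mult_ac)
      ultimately have "emeasure lborel C = ennreal (K * l k ^ DIM('a))" by (simp only:)
      hence "emeasure lborel C = ennreal K * ennreal (l k ^ DIM('a))"
        by (simp only: ennreal_mult'[OF less_imp_le[OF K]])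
      moreover have "C \<in> sets lborel" by (simp add: C_def)
      ultimately have "covers k C" using sub by (simp add: covers_def)
      thus ?thesis ..
    qed
    then obtain C where "\<And>k. covers k (C k)" by metis
    hence C: "\<And>k. C k \<in> sets lborel"
        "\<And>k. {x \<in> E. T x \<in> cbox (c k) (c k + l k *\<^sub>R One)} \<subseteq> C k"
        "\<And>k. emeasure lborel (C k) \<le> ennreal K * ennreal (l k ^ DIM('a))"
      by (auto simp: covers_def)
    have "emeasure lborel E \<le> emeasure lborel (\<Union>k. C k)"
    proof (rule emeasure_mono)
      show "E \<subseteq> (\<Union>k. C k)"
      proof
        fix x assume x: "x \<in> E"
        then obtain k where "T x \<in> cbox (c k) (c k + l k *\<^sub>R One)" using E cl(2) by blast
        thus "x \<in> (\<Union>k. C k)" using C(2)[of k] x by blast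
      qed
    qed (use C(1) in auto)
    also have "\<dots> \<le> (\<Sum>k. emeasure lborel (C k))"
      using C(1) by (intro emeasure_subadditive_countably) auto
    also have "\<dots> \<le> (\<Sum>k. ennreal K * ennreal (l k ^ DIM('a)))"
      by (intro suminf_le C) auto
    also have "\<dots> = ennreal K * (\<Sum>k. ennreal (l k ^ DIM('a)))" by (rule ennreal_suminf_cmult)
    also have "\<dots> \<le> ennreal K * (emeasure lborel A + ennreal (e / K))"
      by (intro mult_left_mono cl) auto
    also have "\<dots> = ennreal K * emeasure lborel A + ennreal e"
      using K e by (simp add: distrib_left ennreal_mult'[symmetric])
    finally show ?thesis .
  qed
  thus ?thesis unfolding K_def N_def by (rule ennreal_le_epsilon)
qed

text \<open>Upper bound: push a fine cover of \<open>B\<close> by intervals forward. Lower bound: pull a cover of the image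
  back; each piece lies in an interval no longer than the diameter of its set.\<close>

lemma hausdorff1_isometric_image:
  fixes g :: "real \<Rightarrow> 'a::metric_space"
  assumes B: "B \<in> sets borel" "bounded B"
    and g: "\<And>s t. s \<in> B \<Longrightarrow> t \<in> B \<Longrightarrow> dist (g s) (g t) = dist s t"
  shows "hausdorff1 (g ` B) = emeasure lborel B"
proof (rule antisym)
  show "hausdorff1 (g ` B) \<le> emeasure lborel B"
    unfolding hausdorff1_def
  proof (rule SUP_least)
    fix \<delta> :: real assume "\<delta> \<in> {0<..}"
    hence \<delta>: "\<delta> > 0" by simp
    show "hausdorff1_pre \<delta> (g ` B) \<le> emeasure lborel B"
    proof (rule ennreal_le_epsilon)
      fix e :: real assume e: "e > 0"
      obtain c l where cl: "\<And>k. 0 \<le> (l k::real)" "\<And>k. l k \<le> \<delta>"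
        "B \<subseteq> (\<Union>k. cbox (c k) (c k + l k *\<^sub>R One))"
        "(\<Sum>k. ennreal (l k ^ DIM(real))) \<le> emeasure lborel B + ennreal e"
        by (rule cube_cover[OF B e \<delta>]) auto
      define U where "U k = g ` (B \<inter> {c k..c k + l k})" for k
      have cover: "g ` B \<subseteq> (\<Union>k. U k)" using cl(3) by (fastforce simp: U_def)
      have dist_U: "dist x y \<le> l k" if "x \<in> U k" "y \<in> U k" for x y k
        using that g by (auto simp: U_def dist_real_def)
      have bdd: "bounded (U k)" for k
        unfolding bounded_two_points using dist_U by blast
      have diam: "diameter (U k) \<le> l k" for k
        using dist_U cl(1)[of k] by (cases "U k = {}") (auto simp: diameter_def intro!: cSUP_least)
      have "hausdorff1_pre \<delta> (g ` B) \<le> (\<Sum>k. ennreal (diameter (U k)))"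
        unfolding hausdorff1_pre_def
        by (rule INF_lower) (use cover bdd diam cl(2) order_trans in blast)
      also have "\<dots> \<le> (\<Sum>k. ennreal (l k ^ DIM(real)))"
        using diam by (intro suminf_le) (auto intro: ennreal_leI)
      also note cl(4)
      finally show "hausdorff1_pre \<delta> (g ` B) \<le> emeasure lborel B + ennreal e" .
    qed
  qed
next
  have "emeasure lborel B \<le> hausdorff1_pre 1 (g ` B)"
    unfolding hausdorff1_pre_def
  proof (rule INF_greatest)
    fix U :: "nat \<Rightarrow> 'a set"
    assume "U \<in> {U. g ` B \<subseteq> (\<Union>i. U i) \<and> (\<forall>i. bounded (U i) \<and> diameter (U i) \<le> 1)}"
    hence U: "g ` B \<subseteq> (\<Union>i. U i)" "\<And>i. bounded (U i)" by auto
    define V where "V i = {s \<in> B. g s \<in> U i}" for i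
    define C where "C i = (if V i = {} then {} else {Inf (V i)..Sup (V i)})" for i
    have bd: "bdd_above (V i)" "bdd_below (V i)" for i
      using bounded_subset[OF B(2), of "V i"]
      by (auto simp: V_def intro: bounded_imp_bdd_above bounded_imp_bdd_below)
    have len: "emeasure lborel (C i) \<le> ennreal (diameter (U i))" for i
    proof (cases "V i = {}")
      case False
      have d: "s - t \<le> diameter (U i)" if "s \<in> V i" "t \<in> V i" for s t
      proof -
        have "dist (g s) (g t) \<le> diameter (U i)"
          using that by (intro diameter_bounded_bound U) (auto simp: V_def)
        thus ?thesis using g[of s t] that by (auto simp: V_def dist_real_def)
      qed
      have "s - diameter (U i) \<le> Inf (V i)" if "s \<in> V i" for s
        using False d[OF that] by (intro cInf_greatest) (auto simp: algebra_simps)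
      hence "Sup (V i) \<le> Inf (V i) + diameter (U i)"
        using False by (intro cSup_least) (auto simp: algebra_simps)
      moreover have "Inf (V i) \<le> Sup (V i)" using False bd[of i] by (rule_tac cInf_le_cSup) auto
      ultimately show ?thesis using False by (simp add: C_def ennreal_leI)
    qed (simp add: C_def)
    have "emeasure lborel B \<le> emeasure lborel (\<Union>i. C i)"
    proof (rule emeasure_mono)
      show "B \<subseteq> (\<Union>i. C i)"
      proof
        fix s assume s: "s \<in> B"
        then obtain i where "s \<in> V i" using U(1) by (auto simp: V_def)
        hence "s \<in> C i" using bd[of i] by (auto simp: C_def intro: cInf_lower cSup_upper)
        thus "s \<in> (\<Union>i. C i)" by blast
      qed
    qed (auto simp: C_def)
    also have "\<dots> \<le> (\<Sum>i. emeasure lborel (C i))"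
      by (intro emeasure_subadditive_countably) (auto simp: C_def)
    also have "\<dots> \<le> (\<Sum>i. ennreal (diameter (U i)))" by (intro suminf_le len) auto
    finally show "emeasure lborel B \<le> (\<Sum>i. ennreal (diameter (U i)))" .
  qed
  also have "\<dots> \<le> hausdorff1 (g ` B)"
    unfolding hausdorff1_def by (rule SUP_upper) simp
  finally show "emeasure lborel B \<le> hausdorff1 (g ` B)" .
qed

text \<open>The case \<open>x = y\<close> is included: then \<open>sgn (y - x) = 0\<close> and both sides vanish.\<close>

lemma hausdorff1_Int_closed_segment:
  fixes x y :: "'a::euclidean_space"
  assumes A: "A \<in> sets borel"
  shows "hausdorff1 (A \<inter> closed_segment x y) =
           emeasure lborel {s \<in> {0..dist x y}. x + s *\<^sub>R sgn (y - x) \<in> A}"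
proof -
  define g where "g s = x + s *\<^sub>R sgn (y - x)" for s
  define B where "B = {s \<in> {0..dist x y}. g s \<in> A}"
  have "B \<in> sets borel"
  proof -
    have "g \<in> borel_measurable borel" unfolding g_def by measurable
    from measurable_sets[OF this A] have "g -` A \<inter> {0..dist x y} \<in> sets borel" by auto
    moreover have "B = g -` A \<inter> {0..dist x y}" by (auto simp: B_def)
    ultimately show ?thesis by simp
  qed
  moreover have "bounded B" by (rule bounded_subset[of "{0..dist x y}"]) (auto simp: B_def)
  moreover have "dist (g s) (g t) = dist s t" if "s \<in> B" "t \<in> B" for s t
  proof (cases "x = y")
    case True
    thus ?thesis using that by (auto simp: B_def g_def)
  next
    case False
    have "g s - g t = (s - t) *\<^sub>R sgn (y - x)" by (simp add: g_def algebra_simps)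
    thus ?thesis using False by (simp add: dist_norm norm_sgn)
  qed
  ultimately have "hausdorff1 (g ` B) = emeasure lborel B"
    by (rule hausdorff1_isometric_image)
  moreover have "g ` B = A \<inter> closed_segment x y"
  proof -
    have "closed_segment x y = g ` {0..dist x y}"
    proof (cases "x = y")
      case True
      thus ?thesis by (auto simp: g_def)
    next
      case False
      have im: "{0..dist x y} = (\<lambda>u. u * dist x y) ` {0..1}"
        using False image_mult_atLeastAtMost[of "dist x y" 0 1] by (simp add: mult.commute)
      have "g (u * dist x y) = (1 - u) *\<^sub>R x + u *\<^sub>R y" for u
        using False by (simp add: g_def sgn_div_norm dist_norm norm_minus_commute algebra_simps)
      thus ?thesis
        unfolding closed_segment_image_interval im image_image by (simp only:)
    qed
    thus ?thesis by (auto simp: B_def)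
  qed
  ultimately show ?thesis by (simp add: B_def g_def)
qed

section \<open>Uniqueness of nearest points\<close>

text \<open>The translates of a bounded part of \<open>S\<close> by \<open>e / (n + 1)\<close> are pairwise disjoint, have equal volume,
  and all lie in one ball; infinitely many of them fit only if that volume is 0.\<close>

lemma null_set_if_lines_subsingleton:
  fixes S :: "'a::euclidean_space set"
  assumes S: "S \<in> sets borel"
    and line: "\<And>x t. x \<in> S \<Longrightarrow> x + t *\<^sub>R e \<in> S \<Longrightarrow> t = 0"
  shows "S \<in> null_sets lborel"
proof -
  have bounded_part: "emeasure lborel (S \<inter> ball 0 R) = 0" for R
  proof -
    define B where "B = S \<inter> ball 0 R"
    define t where "t n = 1 / (real n + 1)" for n :: nat
    define T where "T n = (+) (t n *\<^sub>R e) ` B" for n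
    have B: "B \<in> sets borel" using S by (auto simp: B_def)
    have "T n = (\<lambda>x. x - t n *\<^sub>R e) -` B" for n
    proof (intro equalityI subsetI)
      fix z assume "z \<in> (\<lambda>x. x - t n *\<^sub>R e) -` B"
      thus "z \<in> T n" unfolding T_def by (intro image_eqI[of _ _ "z - t n *\<^sub>R e"]) auto
    qed (auto simp: T_def)
    moreover have "(\<lambda>x. x - t n *\<^sub>R e) -` B \<in> sets borel" for n
      using B by (intro measurable_sets_borel[of _ borel]) auto
    ultimately have T: "T n \<in> sets borel" for n by simp
    have eq: "emeasure lborel (T n) = emeasure lborel B" for n
    proof -
      have "emeasure lborel (T n) = emeasure (distr lborel borel ((+) (t n *\<^sub>R e))) (T n)"
        by (simp add: lborel_distr_plus)
      also have "\<dots> = emeasure lborel ((+) (t n *\<^sub>R e) -` T n)"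
        using T by (subst emeasure_distr) auto
      also have "(+) (t n *\<^sub>R e) -` T n = B" by (auto simp: T_def)
      finally show ?thesis .
    qed
    have disj: "disjoint_family T"
      unfolding disjoint_family_on_def
    proof (intro ballI impI)
      fix m n :: nat assume mn: "m \<noteq> n"
      have False if "z \<in> T m" "z \<in> T n" for z
      proof -
        from that obtain x y where xy: "x \<in> S" "y \<in> S" "z = t m *\<^sub>R e + x" "z = t n *\<^sub>R e + y"
          by (auto simp: T_def B_def)
        hence "y = x + (t m - t n) *\<^sub>R e" by (simp add: algebra_simps)
        hence "t m - t n = 0" using line[of x "t m - t n"] xy by simp
        thus False using mn by (simp add: t_def divide_simps)
      qed
      thus "T m \<inter> T n = {}" by blast
    qed
    have sub: "(\<Union>n. T n) \<subseteq> ball 0 (R + norm e)"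
    proof
      fix z assume "z \<in> (\<Union>n. T n)"
      then obtain n where "z \<in> T n" by blast
      then obtain x where x: "norm x < R" "z = t n *\<^sub>R e + x" by (auto simp: T_def B_def)
      have "norm z \<le> norm (t n *\<^sub>R e) + norm x" unfolding x by (rule norm_triangle_ineq)
      also have "norm (t n *\<^sub>R e) \<le> 1 * norm e"
        unfolding norm_scaleR by (intro mult_right_mono) (auto simp: t_def)
      finally show "z \<in> ball 0 (R + norm e)" using x by simp
    qed
    have "(\<Sum>n::nat. emeasure lborel B) = emeasure lborel (\<Union>n. T n)"
      using suminf_emeasure[of T lborel] T disj by (auto simp: eq)
    also have "\<dots> \<le> emeasure lborel (ball 0 (R + norm e) :: 'a set)"
      by (rule emeasure_mono[OF sub]) auto
    also have "\<dots> < \<infinity>" by (rule emeasure_bounded_finite) auto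
    finally have fin: "(\<Sum>n::nat. emeasure lborel B) < \<infinity>" .
    have B_fin: "emeasure lborel B = ennreal (measure lborel B)"
      using ennreal_suminf_lessD[OF fin] by (intro emeasure_eq_ennreal_measure) auto
    have "summable (\<lambda>n::nat. measure lborel B)"
      using fin unfolding B_fin by (intro summable_suminf_not_top) auto
    hence "measure lborel B = 0" by (simp add: summable_const_iff)
    thus ?thesis using B_fin by (simp add: B_def)
  qed
  have "S = (\<Union>n::nat. S \<inter> ball 0 (real n))"
  proof (intro equalityI subsetI)
    fix x assume x: "x \<in> S"
    obtain n :: nat where "norm x < real n" using reals_Archimedean2 by blast
    thus "x \<in> (\<Union>n::nat. S \<inter> ball 0 (real n))" using x by auto
  qed auto
  moreover have "(\<Union>n::nat. S \<inter> ball 0 (real n)) \<in> null_sets lborel"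
    using S bounded_part by (intro null_sets_UN) (auto simp: null_sets_def)
  ultimately show ?thesis by simp
qed

text \<open>Nearest-point maps are monotone, being gradients of the convex function
  \<open>x \<mapsto> (norm x)\<^sup>2 / 2 - (infdist x F)\<^sup>2 / 2\<close>; here this is read off from the defining inequalities.\<close>

lemma closest_points_monotone:
  fixes x x' y y' :: "'a::real_inner"
  assumes "dist x y \<le> dist x y'" "dist x' y' \<le> dist x' y"
  shows "0 \<le> (x' - x) \<bullet> (y' - y)"
proof -
  have "(dist x y)\<^sup>2 + (dist x' y')\<^sup>2 \<le> (dist x y')\<^sup>2 + (dist x' y)\<^sup>2"
    using assms by (intro add_mono power_mono) auto
  thus ?thesis
    by (simp add: dist_norm power2_norm_eq_inner inner_commute algebra_simps)
qed

definition nearest_points :: "'a::metric_space set \<Rightarrow> 'a \<Rightarrow> 'a set" where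
  "nearest_points F x = {y \<in> F. dist x y = infdist x F}"

definition multi_nearest :: "'a::metric_space set \<Rightarrow> 'a set" where
  "multi_nearest F = {x. \<exists>y\<in>nearest_points F x. \<exists>z\<in>nearest_points F x. y \<noteq> z}"

lemma nearest_pointsD:
  assumes "y \<in> nearest_points F x"
  shows "y \<in> F" "dist x y = infdist x F" "\<And>q. q \<in> F \<Longrightarrow> dist x y \<le> dist x q"
  using assms infdist_le[of _ F x] by (auto simp: nearest_points_def)

text \<open>A nearest point lies in \<open>C\<close> exactly when passing from \<open>F\<close> to \<open>F \<inter> C\<close> does not increase the distance,
  which is a closed condition. It yields both the measurability of the exceptional set and that of
  the projection.\<close>

lemma closed_nearest_point_in:
  fixes F :: "'a::heine_borel set"
  assumes F: "closed F" and C: "closed C"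
  shows "closed {x. nearest_points F x \<inter> C \<noteq> {}}"
proof (cases "F \<inter> C = {}")
  case True
  hence "{x. nearest_points F x \<inter> C \<noteq> {}} = {}" by (auto simp: nearest_points_def)
  thus ?thesis by (simp only: closed_empty)
next
  case False
  have "(nearest_points F x \<inter> C \<noteq> {}) \<longleftrightarrow> infdist x (F \<inter> C) \<le> infdist x F" for x
  proof
    assume "nearest_points F x \<inter> C \<noteq> {}"
    then obtain y where "y \<in> F \<inter> C" "dist x y = infdist x F" by (auto simp: nearest_points_def)
    thus "infdist x (F \<inter> C) \<le> infdist x F" using infdist_le[of y "F \<inter> C" x] by simp
  next
    assume le: "infdist x (F \<inter> C) \<le> infdist x F"
    obtain y where y: "y \<in> F \<inter> C" "infdist x (F \<inter> C) = dist x y"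
      using infdist_attains_inf[OF closed_Int[OF F C] False] .
    hence "dist x y = infdist x F" using le infdist_le[of y F x] by simp
    thus "nearest_points F x \<inter> C \<noteq> {}" using y by (auto simp: nearest_points_def)
  qed
  hence "{x. nearest_points F x \<inter> C \<noteq> {}} = {x. infdist x (F \<inter> C) \<le> infdist x F}" by simp
  thus ?thesis by (simp add: closed_Collect_le continuous_on_infdist)
qed

text \<open>Two different nearest points are separated in some coordinate \<open>i\<close> by rationals \<open>a < b\<close>. For fixed
  \<open>i\<close>, \<open>a\<close>, \<open>b\<close>, monotonicity of nearest points allows at most one such \<open>x\<close> on each line parallel
  to \<open>i\<close>, so each of these countably many sets is null.\<close>

lemma multi_nearest_null:
  fixes F :: "'a::euclidean_space set"
  assumes F: "closed F"
  shows "multi_nearest F \<in> null_sets lborel"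
proof -
  define S where "S i a b = {x. nearest_points F x \<inter> {y. y \<bullet> i \<le> a} \<noteq> {}} \<inter>
      {x. nearest_points F x \<inter> {y. b \<le> y \<bullet> i} \<noteq> {}}" for i a b
  have cl: "closed (S i a b)" for i a b
    unfolding S_def using F
    by (intro closed_Int closed_nearest_point_in closed_Collect_le continuous_intros)
  have null: "S i a b \<in> null_sets lborel" if "i \<in> Basis" "a < b" for i a b
  proof (rule null_set_if_lines_subsingleton[of _ i])
    show "S i a b \<in> sets borel" using cl by (rule borel_closed)
    have "t \<le> 0" if xS: "x \<in> S i a b" "x + t *\<^sub>R i \<in> S i a b" for x t
    proof (rule ccontr)
      assume t: "\<not> t \<le> 0"
      from xS(1) obtain z where z: "z \<in> nearest_points F x" "b \<le> z \<bullet> i" by (auto simp: S_def)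
      from xS(2) obtain y where y: "y \<in> nearest_points F (x + t *\<^sub>R i)" "y \<bullet> i \<le> a"
        by (auto simp: S_def)
      have "0 \<le> (x + t *\<^sub>R i - x) \<bullet> (y - z)"
        using nearest_pointsD[OF z(1)] nearest_pointsD[OF y(1)]
        by (intro closest_points_monotone) auto
      hence "0 \<le> t * (y \<bullet> i - z \<bullet> i)" by (simp add: inner_diff_right inner_commute)
      hence "z \<bullet> i \<le> y \<bullet> i" using t by (simp add: zero_le_mult_iff)
      thus False using z y \<open>a < b\<close> by linarith
    qed
    note le = this
    fix x t assume x: "x \<in> S i a b" "x + t *\<^sub>R i \<in> S i a b"
    have "- t \<le> 0" by (rule le[of "x + t *\<^sub>R i"]) (use x in auto)
    thus "t = 0" using le[OF x] by simp
  qed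
  have "multi_nearest F = (\<Union>i\<in>Basis. \<Union>a\<in>\<rat>. \<Union>b\<in>{b\<in>\<rat>. a < b}. S i a b)" (is "_ = ?U")
  proof (intro equalityI subsetI)
    fix x assume "x \<in> multi_nearest F"
    then obtain y z where yz: "y \<in> nearest_points F x" "z \<in> nearest_points F x" "y \<noteq> z"
      by (auto simp: multi_nearest_def)
    then obtain i where i: "i \<in> Basis" "y \<bullet> i \<noteq> z \<bullet> i" by (meson euclidean_eqI)
    have "x \<in> ?U" if yz: "y \<in> nearest_points F x" "z \<in> nearest_points F x" "y \<bullet> i < z \<bullet> i" for y z
    proof -
      obtain a where a: "a \<in> \<rat>" "y \<bullet> i < a" "a < z \<bullet> i"
        using Rats_dense_in_real[OF yz(3)] by auto
      obtain b where b: "b \<in> \<rat>" "a < b" "b < z \<bullet> i"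
        using Rats_dense_in_real[OF a(3)] by auto
      have "y \<in> nearest_points F x \<inter> {y. y \<bullet> i \<le> a}" "z \<in> nearest_points F x \<inter> {y. b \<le> y \<bullet> i}"
        using yz a b by auto
      hence "x \<in> S i a b" unfolding S_def by blast
      thus ?thesis using a b i by blast
    qed
    thus "x \<in> ?U" using yz i(2) by (metis linorder_neqE)
  next
    fix x assume "x \<in> ?U"
    then obtain i a b where "a < b" "x \<in> S i a b" by auto
    then obtain y z where yz: "y \<in> nearest_points F x" "z \<in> nearest_points F x"
      "y \<bullet> i \<le> a" "b \<le> z \<bullet> i"
      unfolding S_def by blast
    hence "y \<noteq> z" using \<open>a < b\<close> by auto
    thus "x \<in> multi_nearest F" using yz unfolding multi_nearest_def by blast
  qed
  moreover have "?U \<in> null_sets lborel"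
  proof (rule null_sets_UN'[OF countable_finite[OF finite_Basis]])
    fix i :: 'a assume i: "i \<in> Basis"
    show "(\<Union>a\<in>\<rat>. \<Union>b\<in>{b\<in>\<rat>. a < b}. S i a b) \<in> null_sets lborel"
    proof (rule null_sets_UN'[OF countable_rat])
      fix a :: real
      have "countable {b\<in>\<rat>. a < b}" by (rule countable_subset[OF _ countable_rat]) auto
      thus "(\<Union>b\<in>{b\<in>\<rat>. a < b}. S i a b) \<in> null_sets lborel"
        using null[OF i] by (rule null_sets_UN') auto
    qed
  qed
  ultimately show ?thesis by simp
qed

lemma nearest_points_nonempty:
  fixes F :: "'a::heine_borel set"
  assumes "closed F" "F \<noteq> {}"
  shows "nearest_points F x \<noteq> {}"
proof -
  obtain y where "y \<in> F" "infdist x F = dist x y" using infdist_attains_inf[OF assms] .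
  hence "y \<in> nearest_points F x" by (simp add: nearest_points_def)
  thus ?thesis by blast
qed

lemma closest_point_nearest:
  fixes F :: "'a::euclidean_space set"
  assumes "closed F" "F \<noteq> {}"
  shows "closest_point F x \<in> nearest_points F x"
proof -
  obtain y where y: "y \<in> nearest_points F x" using nearest_points_nonempty[OF assms] by blast
  have "dist x (closest_point F x) \<le> infdist x F"
    using closest_point_le[OF assms(1)] nearest_pointsD(1,2)[OF y] by metis
  thus ?thesis using closest_point_in_set[OF assms] infdist_le[of "closest_point F x" F x]
    by (auto simp: nearest_points_def)
qed

text \<open>A Borel version of the projection: on the null set of points with several nearest points the choice
  is made constant, but still in \<open>F\<close>, so that image measures are carried by \<open>F\<close>.\<close>

definition nearest_proj :: "'a::euclidean_space set \<Rightarrow> 'a \<Rightarrow> 'a" where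
  "nearest_proj F x = (if x \<in> multi_nearest F then SOME y. y \<in> F else closest_point F x)"

lemma nearest_proj_nearest:
  assumes "closed F" "F \<noteq> {}" "x \<notin> multi_nearest F"
  shows "nearest_proj F x \<in> nearest_points F x"
  using closest_point_nearest assms by (auto simp: nearest_proj_def)

lemma nearest_proj_unique:
  assumes "closed F" "F \<noteq> {}" "x \<notin> multi_nearest F" "y \<in> nearest_points F x"
  shows "y = nearest_proj F x"
  using nearest_proj_nearest[OF assms(1-3)] assms(3,4) by (auto simp: multi_nearest_def)

lemma nearest_proj_in: "closed F \<Longrightarrow> F \<noteq> {} \<Longrightarrow> nearest_proj F x \<in> F"
  by (auto simp: nearest_proj_def some_in_eq closest_point_in_set)

lemma measurable_nearest_proj:
  fixes F :: "'a::euclidean_space set"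
  assumes F: "closed F" "F \<noteq> {}"
  shows "nearest_proj F \<in> borel_measurable borel"
proof (rule borel_measurableI)
  fix U :: "'a set" assume U: "open U"
  define C where "C = - U"
  have C: "closed C" using U by (simp add: C_def closed_Compl)
  have N: "multi_nearest F \<in> sets borel" using multi_nearest_null[OF F(1)] by auto
  have "nearest_proj F -` C = (if (SOME y. y \<in> F) \<in> C then multi_nearest F else {}) \<union>
     ({x. nearest_points F x \<inter> C \<noteq> {}} - multi_nearest F)"
    (is "_ = ?R")
  proof (rule set_eqI)
    fix x
    show "x \<in> nearest_proj F -` C \<longleftrightarrow> x \<in> ?R"
    proof (cases "x \<in> multi_nearest F")
      case True
      thus ?thesis by (simp add: nearest_proj_def)
    next
      case False
      hence "nearest_points F x = {nearest_proj F x}"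
        using nearest_proj_nearest[OF F False] nearest_proj_unique[OF F False] by blast
      thus ?thesis using False by simp
    qed
  qed
  also have "\<dots> \<in> sets borel"
    using N closed_nearest_point_in[OF F(1) C] by auto
  finally have "- (nearest_proj F -` C) \<in> sets borel" by (rule borel_comp)
  moreover have "nearest_proj F -` U \<inter> space borel = - (nearest_proj F -` C)" by (auto simp: C_def)
  ultimately show "nearest_proj F -` U \<inter> space borel \<in> sets borel" by simp
qed

section \<open>The optimal plan onto the boundary\<close>

lemma borel_measurable_fst_snd [measurable (raw)]:
  fixes f :: "'c \<Rightarrow> 'a::euclidean_space \<times> 'b::euclidean_space"
  assumes "f \<in> borel_measurable M"
  shows "(\<lambda>x. fst (f x)) \<in> borel_measurable M" "(\<lambda>x. snd (f x)) \<in> borel_measurable M"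
  by (rule measurable_compose[OF assms borel_measurable_continuous_onI], intro continuous_intros)+

lemma borel_measurable_sgn_euclidean [measurable (raw)]:
  fixes f :: "'c \<Rightarrow> 'a::euclidean_space"
  assumes [measurable]: "f \<in> borel_measurable M"
  shows "(\<lambda>x. sgn (f x)) \<in> borel_measurable M"
  unfolding sgn_div_norm by measurable

lemma measurable_hausdorff1_segment:
  fixes A :: "'a::euclidean_space set"
  assumes A[measurable]: "A \<in> sets borel"
  shows "(\<lambda>z. hausdorff1 (A \<inter> closed_segment (fst z) (snd z))) \<in> borel_measurable borel"
proof -
  define Q where "Q = {w \<in> space (borel \<Otimes>\<^sub>M lborel). 0 \<le> snd w \<and> snd w \<le> dist (fst (fst w)) (snd (fst w)) \<and>
     fst (fst w) + snd w *\<^sub>R sgn (snd (fst w) - fst (fst w)) \<in> (A :: 'a set)}"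
  have "Q \<in> sets (borel \<Otimes>\<^sub>M lborel)" unfolding Q_def by measurable
  hence "(\<lambda>z. emeasure lborel (Pair z -` Q)) \<in> borel_measurable borel"
    by (rule lborel.measurable_emeasure_Pair)
  moreover have "emeasure lborel (Pair z -` Q) = hausdorff1 (A \<inter> closed_segment (fst z) (snd z))" for z
    unfolding hausdorff1_Int_closed_segment[OF A]
    by (rule arg_cong[where f = "emeasure lborel"]) (auto simp: Q_def space_pair_measure)
  ultimately show ?thesis by simp
qed

text \<open>Used for the equality case of the lower bound on the transport cost, and for the bound on a density.\<close>

lemma AE_eq_if_nn_integral_le:
  assumes [measurable]: "f \<in> borel_measurable M" "g \<in> borel_measurable M"
    and le: "AE x in M. f x \<le> g x" and int: "integral\<^sup>N M g \<le> integral\<^sup>N M f"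
    and fin: "integral\<^sup>N M f < \<infinity>"
  shows "AE x in M. f x = (g x :: ennreal)"
proof -
  have "(\<integral>\<^sup>+x. g x - f x \<partial>M) = integral\<^sup>N M g - integral\<^sup>N M f"
    using le fin by (intro nn_integral_diff) auto
  also have "\<dots> = 0" using int fin by (subst diff_eq_0_iff_ennreal) auto
  finally have "AE x in M. g x - f x = 0" by (subst (asm) nn_integral_0_iff_AE) auto
  thus ?thesis using le
    by eventually_elim (metis antisym diff_eq_0_iff_ennreal linear top.not_eq_extremum)
qed

text \<open>The second marginal is carried by \<open>F\<close>, so any plan costs at least the integral of the distance to
  \<open>F\<close>, and the plan induced by the projection attains this. For an optimal plan the integrands
  therefore agree almost everywhere: almost every \<open>(x, y)\<close> has \<open>y\<close> nearest to \<open>x\<close>, and as \<open>x\<close> is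
  almost surely not exceptional, \<open>y\<close> is the projection of \<open>x\<close>.\<close>

lemma optimal_plan_to_projection_iff:
  fixes \<mu> :: "'a::euclidean_space measure"
  assumes F: "closed F" "F \<noteq> {}" and sets_\<mu>: "sets \<mu> = sets borel"
    and N: "AE x in \<mu>. x \<notin> multi_nearest F"
    and fin: "(\<integral>\<^sup>+x. ennreal (infdist x F) \<partial>\<mu>) < \<infinity>"
  shows "optimal_plan \<mu> (distr \<mu> borel (nearest_proj F)) \<gamma> \<longleftrightarrow> \<gamma> = distr \<mu> borel (\<lambda>x. (x, nearest_proj F x))"
proof -
  note [measurable_cong] = sets_\<mu>
  have P[measurable]: "nearest_proj F \<in> borel_measurable borel" by (rule measurable_nearest_proj[OF F])
  have pair[measurable]: "(\<lambda>x. (x, nearest_proj F x)) \<in> borel \<rightarrow>\<^sub>M (borel :: ('a \<times> 'a) measure)"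
    by (intro borel_measurable_Pair) auto
  have [measurable]: "(\<lambda>x. ennreal (infdist x F)) \<in> borel_measurable borel"
    by (intro measurable_compose[OF borel_measurable_continuous_onI measurable_ennreal]
        continuous_on_infdist continuous_intros)
  define \<nu> where "\<nu> = distr \<mu> borel (nearest_proj F)"
  define \<gamma>0 where "\<gamma>0 = distr \<mu> borel (\<lambda>x. (x, nearest_proj F x))"
  define I where "I = (\<integral>\<^sup>+x. ennreal (infdist x F) \<partial>\<mu>)"
  have Nb[measurable]: "multi_nearest F \<in> sets borel" using multi_nearest_null[OF F(1)] by auto
  have Fb[measurable]: "F \<in> sets borel" using F(1) by (rule borel_closed)
  have plan0: "\<gamma>0 \<in> transport_plans \<mu> \<nu>"
    unfolding transport_plans_def \<gamma>0_def \<nu>_def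
    by (simp add: distr_distr comp_def sets_\<mu> distr_id2 measurable_cong_sets[OF sets_\<mu> refl])
  have plan: "AE z in \<gamma>. snd z \<in> F" "AE z in \<gamma>. fst z \<notin> multi_nearest F"
    "(\<integral>\<^sup>+z. ennreal (infdist (fst z) F) \<partial>\<gamma>) = I"
    if "\<gamma> \<in> transport_plans \<mu> \<nu>" for \<gamma>
  proof -
    from that have sets_\<gamma>: "sets \<gamma> = sets borel" and m: "distr \<gamma> borel fst = \<mu>" "distr \<gamma> borel snd = \<nu>"
      by (auto simp: transport_plans_def)
    note [measurable_cong] = sets_\<gamma>
    have "AE y in \<nu>. y \<in> F"
      unfolding \<nu>_def by (subst AE_distr_iff) (auto simp: nearest_proj_in[OF F])
    thus "AE z in \<gamma>. snd z \<in> F" unfolding m(2)[symmetric] by (subst (asm) AE_distr_iff) auto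
    show "AE z in \<gamma>. fst z \<notin> multi_nearest F"
      using N unfolding m(1)[symmetric] by (subst (asm) AE_distr_iff) auto
    show "(\<integral>\<^sup>+z. ennreal (infdist (fst z) F) \<partial>\<gamma>) = I"
      unfolding I_def m(1)[symmetric] by (subst nn_integral_distr) auto
  qed
  have cost_ge: "I \<le> transport_cost \<gamma>" if "\<gamma> \<in> transport_plans \<mu> \<nu>" for \<gamma>
  proof -
    have "I = (\<integral>\<^sup>+z. ennreal (infdist (fst z) F) \<partial>\<gamma>)" using plan(3)[OF that] by simp
    also have "\<dots> \<le> (\<integral>\<^sup>+z. ennreal (dist (fst z) (snd z)) \<partial>\<gamma>)"
      using plan(1)[OF that]
      by (intro nn_integral_mono_AE) (auto elim!: eventually_mono intro!: ennreal_leI infdist_le)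
    finally show ?thesis by (simp add: transport_cost_def case_prod_beta')
  qed
  have cost0: "transport_cost \<gamma>0 = I"
  proof -
    have "transport_cost \<gamma>0 = (\<integral>\<^sup>+x. ennreal (dist x (nearest_proj F x)) \<partial>\<mu>)"
      unfolding transport_cost_def \<gamma>0_def case_prod_beta' by (subst nn_integral_distr) auto
    also have "\<dots> = I" unfolding I_def
      using N by (intro nn_integral_cong_AE)
        (auto elim!: eventually_mono dest: nearest_proj_nearest[OF F] simp: nearest_points_def)
    finally show ?thesis .
  qed
  have "\<gamma> = \<gamma>0" if opt: "optimal_plan \<mu> \<nu> \<gamma>"
  proof -
    have pl: "\<gamma> \<in> transport_plans \<mu> \<nu>" using opt by (simp add: optimal_plan_def)
    hence sets_\<gamma>: "sets \<gamma> = sets borel" and m: "distr \<gamma> borel fst = \<mu>"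
      by (auto simp: transport_plans_def)
    note [measurable_cong] = sets_\<gamma>
    have "transport_cost \<gamma> \<le> I" using opt plan0 cost0 by (auto simp: optimal_plan_def)
    hence "AE z in \<gamma>. ennreal (infdist (fst z) F) = ennreal (dist (fst z) (snd z))"
      using plan[OF pl] fin
      by (intro AE_eq_if_nn_integral_le)
         (auto elim!: eventually_mono intro!: ennreal_leI infdist_le
            simp: transport_cost_def case_prod_beta' I_def)
    hence "AE z in \<gamma>. z = (fst z, nearest_proj F (fst z))"
      using plan(1,2)[OF pl]
    proof eventually_elim
      case (elim z)
      hence "snd z \<in> nearest_points F (fst z)" by (simp add: nearest_points_def infdist_nonneg)
      hence "snd z = nearest_proj F (fst z)" using nearest_proj_unique[OF F] elim by blast
      thus ?case by (metis prod.collapse)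
    qed
    hence "distr \<gamma> borel (\<lambda>z. z) = distr \<gamma> borel (\<lambda>z. (fst z, nearest_proj F (fst z)))"
      by (intro distr_cong_AE) auto
    also have "\<dots> = distr (distr \<gamma> borel fst) borel (\<lambda>x. (x, nearest_proj F x))"
      by (subst distr_distr) (auto simp: comp_def)
    also have "\<dots> = \<gamma>0" by (simp add: m \<gamma>0_def)
    finally show ?thesis using distr_id2[OF sets_\<gamma>[symmetric]] by simp
  qed
  moreover have "optimal_plan \<mu> \<nu> \<gamma>0"
    using plan0 cost0 cost_ge by (simp add: optimal_plan_def)
  ultimately show ?thesis unfolding \<nu>_def[symmetric] \<gamma>0_def[symmetric] by blast
qed

text \<open>On the complement of the null set the chosen minimiser is the Borel version of the projection; on
  the null set the completion makes every choice measurable and irrelevant.\<close>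

lemma boundary_projection_image_eq:
  fixes \<mu> :: "'a::euclidean_space measure"
  assumes F: "frontier \<Omega> \<noteq> {}" and sets_\<mu>: "sets \<mu> = sets borel"
    and N: "multi_nearest (frontier \<Omega>) \<in> null_sets \<mu>"
  shows "boundary_projection_image \<Omega> \<mu> = distr \<mu> borel (nearest_proj (frontier \<Omega>))"
proof -
  let ?c = "closest_point (frontier \<Omega>)" and ?P = "nearest_proj (frontier \<Omega>)" and ?N = "multi_nearest (frontier \<Omega>)"
  have sp: "space \<mu> = UNIV" using sets_eq_imp_space_eq[OF sets_\<mu>] by simp
  have P: "?P \<in> \<mu> \<rightarrow>\<^sub>M borel"
    using measurable_nearest_proj[OF frontier_closed F] by (simp add: measurable_cong_sets[OF sets_\<mu> refl])
  show ?thesis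
  proof (rule measure_eqI)
    fix A assume "A \<in> sets (boundary_projection_image \<Omega> \<mu>)"
    hence A: "A \<in> sets borel" by (simp add: boundary_projection_image_def)
    have PA: "?P -` A - ?N \<in> sets \<mu>"
      using measurable_sets[OF P A] N sp by auto
    have c: "?c -` B = (?P -` B - ?N) \<union> (?c -` B \<inter> ?N)" for B by (auto simp: nearest_proj_def)
    have cm: "?c \<in> completion \<mu> \<rightarrow>\<^sub>M borel"
    proof (rule measurableI)
      fix B :: "'a set" assume B: "B \<in> sets borel"
      have "?P -` B - ?N \<in> sets \<mu>" using measurable_sets[OF P B] N sp by auto
      hence "?c -` B \<in> sets (completion \<mu>)"
        using c[of B] N by (intro sets_completionI[where N = "?c -` B \<inter> ?N" and N' = ?N]) auto
      thus "?c -` B \<inter> space (completion \<mu>) \<in> sets (completion \<mu>)" by (simp add: sp)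
    qed simp
    have Nc: "?c -` A \<inter> ?N \<in> null_sets (completion \<mu>)"
      using null_sets_completionI[OF N] by (rule null_sets_completion_subset[rotated]) auto
    have Nm: "?P -` A \<inter> ?N \<in> null_sets \<mu>"
      using measurable_sets[OF P A] N sp by (intro null_set_Int1) auto
    have "emeasure (boundary_projection_image \<Omega> \<mu>) A = emeasure (completion \<mu>) (?c -` A)"
      unfolding boundary_projection_image_def using cm A by (simp add: emeasure_distr sp)
    also have "\<dots> = emeasure (completion \<mu>) (?P -` A - ?N)"
      using c[of A] emeasure_Un_null_set[OF _ Nc] PA by (metis sets_completionI_sets)
    also have "\<dots> = emeasure \<mu> (?P -` A - ?N)" using PA by simp
    also have "\<dots> = emeasure \<mu> ((?P -` A - ?N) \<union> (?P -` A \<inter> ?N))"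
      using emeasure_Un_null_set[OF PA Nm] by simp
    also have "(?P -` A - ?N) \<union> (?P -` A \<inter> ?N) = ?P -` A" by blast
    also have "emeasure \<mu> (?P -` A) = emeasure (distr \<mu> borel ?P) A"
      using P A by (simp add: emeasure_distr sp)
    finally show "emeasure (boundary_projection_image \<Omega> \<mu>) A = emeasure (distr \<mu> borel ?P) A" .
  qed (simp add: boundary_projection_image_def)
qed

section \<open>The transport density as a flow along normals\<close>

text \<open>The occupation measure of a flow: each particle, distributed according to \<open>\<mu>\<close>, deposits its mass
  along its trajectory at unit rate for those times \<open>s\<close> with \<open>(x, s) \<in> W\<close>.\<close>

definition flow_push :: "('a::euclidean_space \<times> real) set \<Rightarrow> ('a \<times> real \<Rightarrow> 'a) \<Rightarrow> 'a measure \<Rightarrow> 'a measure" where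
  "flow_push W \<psi> \<mu> = distr (density (\<mu> \<Otimes>\<^sub>M lborel) (indicator W)) borel \<psi>"

lemma sets_flow_push [simp, measurable_cong]: "sets (flow_push W \<psi> \<mu>) = sets borel"
  by (simp add: flow_push_def)

lemma space_flow_push [simp]: "space (flow_push W \<psi> \<mu>) = UNIV"
  by (simp add: flow_push_def)

lemma nn_integral_flow_push:
  fixes \<phi> :: "'a::euclidean_space \<Rightarrow> ennreal"
  assumes sets_\<mu>: "sets \<mu> = sets borel"
    and [measurable]: "W \<in> sets (borel \<Otimes>\<^sub>M borel)" "\<psi> \<in> borel \<Otimes>\<^sub>M borel \<rightarrow>\<^sub>M borel"
      "\<phi> \<in> borel_measurable borel"
  shows "(\<integral>\<^sup>+z. \<phi> z \<partial>flow_push W \<psi> \<mu>) =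
           (\<integral>\<^sup>+x. \<integral>\<^sup>+s. indicator W (x, s) * \<phi> (\<psi> (x, s)) \<partial>lborel \<partial>\<mu>)"
proof -
  note [measurable_cong] = sets_\<mu>
  have "(\<integral>\<^sup>+z. \<phi> z \<partial>flow_push W \<psi> \<mu>) = (\<integral>\<^sup>+w. indicator W w * \<phi> (\<psi> w) \<partial>(\<mu> \<Otimes>\<^sub>M lborel))"
    unfolding flow_push_def by (subst nn_integral_distr) (auto simp: nn_integral_density)
  also have "\<dots> = (\<integral>\<^sup>+x. \<integral>\<^sup>+s. indicator W (x, s) * \<phi> (\<psi> (x, s)) \<partial>lborel \<partial>\<mu>)"
    by (rule lborel.nn_integral_fst[symmetric]) measurable
  finally show ?thesis .
qed

lemma emeasure_flow_push:
  fixes \<mu> :: "'a::euclidean_space measure"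
  assumes "sets \<mu> = sets borel"
    and "W \<in> sets (borel \<Otimes>\<^sub>M borel)" "\<psi> \<in> borel \<Otimes>\<^sub>M borel \<rightarrow>\<^sub>M borel" "A \<in> sets borel"
  shows "emeasure (flow_push W \<psi> \<mu>) A =
           (\<integral>\<^sup>+x. \<integral>\<^sup>+s. indicator W (x, s) * indicator A (\<psi> (x, s)) \<partial>lborel \<partial>\<mu>)"
  using nn_integral_flow_push[OF assms(1-3), of "indicator A"] assms(4) by simp

definition ray_region :: "'a::euclidean_space set \<Rightarrow> ('a \<times> real) set" where
  "ray_region \<Omega> = {(x, s). x \<in> \<Omega> \<and> x \<notin> multi_nearest (frontier \<Omega>) \<and> 0 < s \<and>
     s < dist x (nearest_proj (frontier \<Omega>) x)}"

definition ray_flow :: "'a::euclidean_space set \<Rightarrow> 'a \<times> real \<Rightarrow> 'a" where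
  "ray_flow F = (\<lambda>(x, s). x + s *\<^sub>R sgn (nearest_proj F x - x))"

definition ray_transport :: "'a::euclidean_space set \<Rightarrow> 'a measure \<Rightarrow> 'a measure" where
  "ray_transport \<Omega> = flow_push (ray_region \<Omega>) (ray_flow (frontier \<Omega>))"

lemma bounded_domain_frontier:
  assumes "bounded_domain \<Omega>"
  shows "frontier \<Omega> \<noteq> {}" "closed (frontier \<Omega>)" "\<Omega> \<in> sets borel"
  using assms not_bounded_UNIV unfolding bounded_domain_def
  by (auto simp: frontier_eq_empty)

lemma measurable_ray_flow:
  assumes "closed F" "F \<noteq> {}"
  shows "ray_flow F \<in> borel \<Otimes>\<^sub>M borel \<rightarrow>\<^sub>M borel"
proof -
  note measurable_nearest_proj[OF assms, measurable]
  show ?thesis unfolding ray_flow_def by measurable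
qed

lemma measurable_ray_region:
  assumes "bounded_domain \<Omega>"
  shows "ray_region \<Omega> \<in> sets (borel \<Otimes>\<^sub>M borel)"
proof -
  note F = bounded_domain_frontier[OF assms]
  note measurable_nearest_proj[OF F(2,1), measurable]
  have [measurable]: "multi_nearest (frontier \<Omega>) \<in> sets borel" "\<Omega> \<in> sets borel"
    using multi_nearest_null[OF F(2)] F(3) by auto
  have "ray_region \<Omega> = {w \<in> space (borel \<Otimes>\<^sub>M borel). fst w \<in> \<Omega> \<and>
      fst w \<notin> multi_nearest (frontier \<Omega>) \<and> 0 < snd w \<and> snd w < dist (fst w) (nearest_proj (frontier \<Omega>) (fst w))}"
    by (auto simp: ray_region_def space_pair_measure)
  also have "\<dots> \<in> sets (borel \<Otimes>\<^sub>M borel)" by measurable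
  finally show ?thesis .
qed

lemma dist_to_frontier_le_diameter:
  assumes "bounded_domain \<Omega>" "x \<in> \<Omega>" "p \<in> frontier \<Omega>"
  shows "dist x p \<le> diameter \<Omega>"
proof -
  have "dist x p \<le> diameter (closure \<Omega>)"
    using assms closure_subset
    by (intro diameter_bounded_bound) (auto simp: bounded_domain_def frontier_def)
  thus ?thesis using assms(1) by (simp add: diameter_closure bounded_domain_def)
qed

lemma ray_regionD:
  assumes "bounded_domain \<Omega>" "(x, s) \<in> ray_region \<Omega>"
  shows "x \<in> \<Omega>" "nearest_proj (frontier \<Omega>) x \<in> frontier \<Omega>"
    "\<And>q. q \<in> frontier \<Omega> \<Longrightarrow> dist x (nearest_proj (frontier \<Omega>) x) \<le> dist x q"
    "0 < s" "s < dist x (nearest_proj (frontier \<Omega>) x)" "s \<le> diameter \<Omega>"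
    "ray_flow (frontier \<Omega>) (x, s) \<in> \<Omega>"
proof -
  note F = bounded_domain_frontier[OF assms(1)]
  show x: "x \<in> \<Omega>" and s: "0 < s" "s < dist x (nearest_proj (frontier \<Omega>) x)"
    using assms(2) by (auto simp: ray_region_def)
  have p: "nearest_proj (frontier \<Omega>) x \<in> nearest_points (frontier \<Omega>) x"
    using assms(2) by (intro nearest_proj_nearest F) (auto simp: ray_region_def)
  show P: "nearest_proj (frontier \<Omega>) x \<in> frontier \<Omega>"
    and near: "\<And>q. q \<in> frontier \<Omega> \<Longrightarrow> dist x (nearest_proj (frontier \<Omega>) x) \<le> dist x q"
    using nearest_pointsD[OF p] by auto
  show "s \<le> diameter \<Omega>" using dist_to_frontier_le_diameter[OF assms(1) x P] s by simp
  have "ball x (dist x (nearest_proj (frontier \<Omega>) x)) \<subseteq> \<Omega>"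
    by (rule ball_subset_if_no_frontier[OF x near])
  moreover have "dist x (ray_flow (frontier \<Omega>) (x, s)) \<le> s"
    using s by (simp add: ray_flow_def dist_norm norm_sgn)
  ultimately show "ray_flow (frontier \<Omega>) (x, s) \<in> \<Omega>" using s by (auto simp: subset_iff)
qed

text \<open>Only the two end points of the ray distinguish the closed segment from the region \<open>0 < s < d x\<close>.\<close>

lemma ray_transport_section:
  fixes \<Omega> :: "'a::euclidean_space set"
  assumes x: "x \<in> \<Omega>" "x \<notin> multi_nearest (frontier \<Omega>)" and A: "A \<in> sets borel"
    and F: "frontier \<Omega> \<noteq> {}"
  shows "hausdorff1 (A \<inter> closed_segment x (nearest_proj (frontier \<Omega>) x)) =
    (\<integral>\<^sup>+s. indicator (ray_region \<Omega>) (x, s) * indicator A (ray_flow (frontier \<Omega>) (x, s)) \<partial>lborel)"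
proof -
  define p where "p = nearest_proj (frontier \<Omega>) x"
  define S where "S = {s \<in> {0..dist x p}. x + s *\<^sub>R sgn (p - x) \<in> A}"
  have "S = {0..dist x p} \<inter> (\<lambda>s. x + s *\<^sub>R sgn (p - x)) -` A" by (auto simp: S_def)
  moreover have "(\<lambda>s. x + s *\<^sub>R sgn (p - x)) -` A \<in> sets borel"
    using A by (intro measurable_sets_borel[of _ borel]) auto
  ultimately have S: "S \<in> sets borel" by simp
  have "emeasure lborel S = (\<integral>\<^sup>+s. indicator S s \<partial>lborel)" using S by simp
  also have "\<dots> = (\<integral>\<^sup>+s. indicator (ray_region \<Omega>) (x, s) * indicator A (ray_flow (frontier \<Omega>) (x, s)) \<partial>lborel)"
  proof (rule nn_integral_cong_AE)
    have "AE s in lborel. s \<noteq> 0" "AE s in lborel. s \<noteq> dist x p"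
      by (rule AE_lborel_singleton)+
    thus "AE s in lborel. indicator S s = indicator (ray_region \<Omega>) (x, s) *
        (indicator A (ray_flow (frontier \<Omega>) (x, s)) :: ennreal)"
      by eventually_elim
        (use x in \<open>auto simp: S_def ray_region_def ray_flow_def p_def indicator_def\<close>)
  qed
  finally show ?thesis
    unfolding hausdorff1_Int_closed_segment[OF A] p_def[symmetric] S_def .
qed

text \<open>The optimal plan is unique, so the description of the transport density determines it completely, and
  it can be evaluated ray by ray.\<close>

lemma transport_density_eq_ray_transport:
  fixes \<Omega> :: "'a::euclidean_space set"
  assumes \<Omega>: "bounded_domain \<Omega>" and f: "ac_measure_on \<Omega> f"
  shows "transport_density f (boundary_projection_image \<Omega> f) = ray_transport \<Omega> f"
proof -
  note F = bounded_domain_frontier[OF \<Omega>]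
  note N = multi_nearest_null[OF F(2)]
  have sets_f: "sets f = sets borel" and fin: "finite_measure f"
    and ac: "absolutely_continuous lborel f" and out: "emeasure f (- \<Omega>) = 0"
    using f by (auto simp: ac_measure_on_def)
  note [measurable_cong] = sets_f
  have Nf: "multi_nearest (frontier \<Omega>) \<in> null_sets f"
    using N ac by (auto simp: absolutely_continuous_def)
  have AE_N: "AE x in f. x \<notin> multi_nearest (frontier \<Omega>)" using Nf by (rule AE_not_in)
  have "- \<Omega> \<in> null_sets f" using out F(3) sets_f by auto
  hence AE_\<Omega>: "AE x in f. x \<in> \<Omega>" using AE_not_in by fastforce
  have "(\<integral>\<^sup>+x. ennreal (infdist x (frontier \<Omega>)) \<partial>f) \<le> (\<integral>\<^sup>+x. ennreal (diameter \<Omega>) \<partial>f)"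
  proof (rule nn_integral_mono_AE, use AE_\<Omega> in eventually_elim, rule ennreal_leI)
    fix x assume "x \<in> \<Omega>"
    obtain p where "p \<in> frontier \<Omega>" using F(1) by blast
    thus "infdist x (frontier \<Omega>) \<le> diameter \<Omega>"
      using dist_to_frontier_le_diameter[OF \<Omega> \<open>x \<in> \<Omega>\<close>] infdist_le order_trans by metis
  qed
  also have "\<dots> < \<infinity>"
    using finite_measure.emeasure_finite[OF fin] by (simp add: ennreal_mult_less_top less_top)
  finally have cost: "(\<integral>\<^sup>+x. ennreal (infdist x (frontier \<Omega>)) \<partial>f) < \<infinity>" .
  define \<gamma>0 where "\<gamma>0 = distr f borel (\<lambda>x. (x, nearest_proj (frontier \<Omega>) x))"
  have opt: "optimal_plan f (boundary_projection_image \<Omega> f) \<gamma> \<longleftrightarrow> \<gamma> = \<gamma>0" for \<gamma>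
    unfolding boundary_projection_image_eq[OF F(1) sets_f Nf] \<gamma>0_def
    by (rule optimal_plan_to_projection_iff[OF F(2,1) sets_f AE_N cost])
  note measurable_nearest_proj[OF F(2,1), measurable]
  have density: "(\<integral>\<^sup>+ (x, y). hausdorff1 (A \<inter> closed_segment x y) \<partial>\<gamma>0) = emeasure (ray_transport \<Omega> f) A"
    if A: "A \<in> sets borel" for A
  proof -
    have "(\<integral>\<^sup>+ (x, y). hausdorff1 (A \<inter> closed_segment x y) \<partial>\<gamma>0) =
        (\<integral>\<^sup>+x. hausdorff1 (A \<inter> closed_segment x (nearest_proj (frontier \<Omega>) x)) \<partial>f)"
      unfolding \<gamma>0_def case_prod_beta'
      by (subst nn_integral_distr)
        (auto intro!: borel_measurable_Pair measurable_hausdorff1_segment[OF A])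
    also have "\<dots> = (\<integral>\<^sup>+x. \<integral>\<^sup>+s. indicator (ray_region \<Omega>) (x, s) *
        indicator A (ray_flow (frontier \<Omega>) (x, s)) \<partial>lborel \<partial>f)"
      by (rule nn_integral_cong_AE, use AE_N AE_\<Omega> in eventually_elim)
        (rule ray_transport_section[OF _ _ A F(1)])
    also have "\<dots> = emeasure (ray_transport \<Omega> f) A"
      unfolding ray_transport_def
      by (rule emeasure_flow_push[symmetric, OF sets_f measurable_ray_region[OF \<Omega>]
          measurable_ray_flow[OF F(2,1)] A])
    finally show ?thesis .
  qed
  have "is_transport_density f (boundary_projection_image \<Omega> f) \<sigma> \<longleftrightarrow> \<sigma> = ray_transport \<Omega> f" for \<sigma>
    unfolding is_transport_density_def opt
    by (auto simp: density ray_transport_def intro!: measure_eqI)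
  thus ?thesis unfolding transport_density_def by (intro the_equality) auto
qed

text \<open>By Fubini it suffices to look at a fixed time \<open>s\<close>, where the flow is expansive; times beyond the
  diameter contribute nothing.\<close>

lemma ray_transport_lborel_le:
  fixes \<Omega> :: "'a::euclidean_space set"
  assumes \<Omega>: "bounded_domain \<Omega>" and ext: "exterior_ball_condition r \<Omega>" and r: "r > 0"
    and D: "diameter \<Omega> \<le> D" "D > 0" and A: "A \<in> sets borel"
  shows "emeasure (ray_transport \<Omega> lborel) A \<le>
           ennreal (D * (2 * (2 + 2 * D / r) * DIM('a)) ^ DIM('a)) * emeasure lborel A"
proof -
  note F = bounded_domain_frontier[OF \<Omega>]
  note A[measurable] F(3)[measurable] measurable_ray_region[OF \<Omega>, measurable]
    measurable_ray_flow[OF F(2,1), measurable]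
  define K where "K = (2 * (2 + 2 * D / r) * DIM('a)) ^ DIM('a)"
  have M: "2 + 2 * D / r > 0" using D r by (simp add: add_pos_pos)
  hence K: "K > 0" by (simp add: K_def)
  have slice: "(\<integral>\<^sup>+x. indicator (ray_region \<Omega>) (x, s) *
      indicator A (ray_flow (frontier \<Omega>) (x, s)) \<partial>lborel) \<le>
      ennreal K * emeasure lborel A * indicator {0..D} s" for s
  proof -
    define E where "E = {x. (x, s) \<in> ray_region \<Omega> \<and> ray_flow (frontier \<Omega>) (x, s) \<in> A}"
    have "E = {x \<in> space borel. (x, s) \<in> ray_region \<Omega> \<and> ray_flow (frontier \<Omega>) (x, s) \<in> A}"
      by (simp add: E_def)
    also have "\<dots> \<in> sets borel" by measurable
    finally have E: "E \<in> sets borel" .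
    have eq: "(\<integral>\<^sup>+x. indicator (ray_region \<Omega>) (x, s) *
        indicator A (ray_flow (frontier \<Omega>) (x, s)) \<partial>lborel) = emeasure lborel E"
    proof -
      have "(\<integral>\<^sup>+x. indicator (ray_region \<Omega>) (x, s) *
        indicator A (ray_flow (frontier \<Omega>) (x, s)) \<partial>lborel) = (\<integral>\<^sup>+x. indicator E x \<partial>lborel)"
        by (rule nn_integral_cong) (auto simp: E_def indicator_def)
      thus ?thesis using E by simp
    qed
    show ?thesis
    proof (cases "E = {}")
      case True
      thus ?thesis unfolding eq by simp
    next
      case False
      then obtain x0 where "(x0, s) \<in> ray_region \<Omega>" by (auto simp: E_def)
      hence s: "s \<in> {0..D}" using ray_regionD(4,6)[OF \<Omega>, of x0 s] D(1) by auto
      have "emeasure lborel E \<le> ennreal K * emeasure lborel (A \<inter> \<Omega>)"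
        unfolding K_def
      proof (rule emeasure_le_if_expansive[where T = "\<lambda>x. ray_flow (frontier \<Omega>) (x, s)"])
        show "A \<inter> \<Omega> \<in> sets borel" by measurable
        show "bounded (A \<inter> \<Omega>)" using \<Omega> by (auto simp: bounded_domain_def)
        show "(\<lambda>x. ray_flow (frontier \<Omega>) (x, s)) ` E \<subseteq> A \<inter> \<Omega>"
          using ray_regionD(7)[OF \<Omega>] by (auto simp: E_def)
        show "2 + 2 * D / r > 0" by (rule M)
        fix x x' assume "x \<in> E" "x' \<in> E"
        hence W: "(x, s) \<in> ray_region \<Omega>" "(x', s) \<in> ray_region \<Omega>" by (auto simp: E_def)
        show "dist x x' \<le> (2 + 2 * D / r) *
            dist (ray_flow (frontier \<Omega>) (x, s)) (ray_flow (frontier \<Omega>) (x', s))"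
          unfolding ray_flow_def prod.case
          by (rule normal_flow_expansive[OF ext r])
            (use ray_regionD[OF \<Omega> W(1)] ray_regionD[OF \<Omega> W(2)] D(1) in auto)
      qed
      also have "\<dots> \<le> ennreal K * emeasure lborel A"
        by (intro mult_left_mono emeasure_mono) auto
      finally show ?thesis unfolding eq using s by simp
    qed
  qed
  have "emeasure (ray_transport \<Omega> lborel) A = (\<integral>\<^sup>+x. \<integral>\<^sup>+s. indicator (ray_region \<Omega>) (x, s) *
      indicator A (ray_flow (frontier \<Omega>) (x, s)) \<partial>lborel \<partial>lborel)"
    unfolding ray_transport_def
    by (rule emeasure_flow_push) (auto simp: F measurable_ray_region[OF \<Omega>] measurable_ray_flow)
  also have "\<dots> = (\<integral>\<^sup>+s. \<integral>\<^sup>+x. indicator (ray_region \<Omega>) (x, s) *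
      indicator A (ray_flow (frontier \<Omega>) (x, s)) \<partial>lborel \<partial>lborel)"
    by (rule lborel_pair.Fubini'[symmetric]) measurable
  also have "\<dots> \<le> (\<integral>\<^sup>+s. ennreal K * emeasure lborel A * indicator {0..D} s \<partial>lborel)"
    by (intro nn_integral_mono slice)
  also have "\<dots> = ennreal K * emeasure lborel A * ennreal D"
    using D by (subst nn_integral_cmult_indicator) auto
  also have "\<dots> = ennreal (D * K) * emeasure lborel A"
    using D K by (simp add: ennreal_mult mult_ac)
  finally show ?thesis by (simp add: K_def)
qed

section \<open>Summability\<close>

text \<open>Weighted arithmetic-geometric mean inequality for \<open>B powr (p - 1) * \<eta> powr p\<close> and
  \<open>b powr p / B\<close> with weights \<open>1 / p\<close> and \<open>1 - 1 / p\<close>. The weight on \<open>b\<close> is chosen so that this term,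
  after being multiplied by \<open>B\<close>, can be absorbed.\<close>

lemma Young_powr:
  fixes p B b \<eta> :: real
  assumes p: "p \<ge> 1" and B: "B > 0" and nn: "b \<ge> 0" "\<eta> \<ge> 0"
  shows "\<eta> * b powr (p - 1) \<le> (1 - 1 / p) / B * b powr p + B powr (p - 1) / p * \<eta> powr p"
proof (cases "b = 0 \<or> \<eta> = 0")
  case True
  have "0 \<le> (1 - 1 / p) / B * b powr p" using p B by simp
  moreover have "0 \<le> B powr (p - 1) / p * \<eta> powr p" using p by simp
  ultimately show ?thesis using True by auto
next
  case False
  hence pos: "b > 0" "\<eta> > 0" using nn by auto
  define u where "u = B powr (p - 1) * \<eta> powr p"
  define v where "v = b powr p / B"
  have exponents: "(p - 1) * (1 / p) = 1 - 1 / p" "p * (1 / p) = 1" "p * (1 - 1 / p) = p - 1"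
    using p by (auto simp: field_simps)
  have "u powr (1 / p) = B powr (1 - 1 / p) * \<eta>"
    unfolding u_def powr_mult powr_powr exponents using pos by simp
  moreover have "v powr (1 - 1 / p) = b powr (p - 1) / B powr (1 - 1 / p)"
    unfolding v_def powr_divide powr_powr exponents ..
  ultimately have "u powr (1 / p) * v powr (1 - 1 / p) = \<eta> * b powr (p - 1)"
    using B by simp
  moreover have "u powr (1 / p) * v powr (1 - 1 / p) \<le> 1 / p * u + (1 - 1 / p) * v"
    using p B pos by (intro Youngs_inequality_0) (auto simp: u_def v_def)
  ultimately show ?thesis by (simp add: u_def v_def)
qed

lemma AE_le_if_emeasure_density_le:
  fixes g :: "'a::euclidean_space \<Rightarrow> ennreal"
  assumes g[measurable]: "g \<in> borel_measurable borel"
    and \<Omega>[measurable]: "\<Omega> \<in> sets borel" and fin: "emeasure lborel \<Omega> < \<infinity>" and k: "k < \<infinity>"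
    and le: "\<And>A. A \<in> sets borel \<Longrightarrow> A \<subseteq> \<Omega> \<Longrightarrow> (\<integral>\<^sup>+x. g x * indicator A x \<partial>lborel) \<le> k * emeasure lborel A"
  shows "AE x in lborel. x \<in> \<Omega> \<longrightarrow> g x \<le> k"
proof -
  define A where "A = {x \<in> space borel. x \<in> \<Omega> \<and> k < g x}"
  have A[measurable]: "A \<in> sets borel" unfolding A_def by measurable
  have sub: "A \<subseteq> \<Omega>" by (auto simp: A_def)
  have kA: "(\<integral>\<^sup>+x. k * indicator A x \<partial>lborel) = k * emeasure lborel A"
    by (rule nn_integral_cmult_indicator) simp
  have "emeasure lborel A \<le> emeasure lborel \<Omega>" by (rule emeasure_mono[OF sub]) simp
  hence "emeasure lborel A < \<infinity>" using fin by (rule le_less_trans)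
  hence "k * emeasure lborel A < \<infinity>" using k by (simp add: ennreal_mult_less_top)
  hence "AE x in lborel. k * indicator A x = g x * indicator A x"
    using le[OF A sub] kA
    by (intro AE_eq_if_nn_integral_le) (auto simp: A_def indicator_def less_imp_le)
  thus ?thesis
  proof eventually_elim
    case (elim x)
    thus ?case by (cases "x \<in> A") (auto simp: A_def indicator_def)
  qed
qed

lemma ennreal_powr_mono_scaled:
  assumes p: "p \<ge> 1" and B: "B > 0" and le: "I \<le> ennreal (B powr p) * H"
  shows "ennreal_powr I (1 / p) \<le> ennreal B * ennreal_powr H (1 / p)"
proof (cases H)
  case top
  thus ?thesis using B by (simp add: ennreal_powr_def ennreal_mult_top)
next
  case (real h)
  hence "I \<le> ennreal (B powr p * h)" using le by (simp add: ennreal_mult')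
  then obtain i where i: "I = ennreal i" "0 \<le> i" "i \<le> B powr p * h"
    using real B by (cases I) (auto simp: ennreal_le_iff top_unique)
  have "i powr (1 / p) \<le> (B powr p * h) powr (1 / p)"
    using i p by (intro powr_mono2) auto
  also have "\<dots> = B * h powr (1 / p)" using p B real by (simp add: powr_mult powr_powr)
  finally show ?thesis using i real B by (simp add: ennreal_powr_def ennreal_mult'[symmetric])
qed

lemma measurable_ennreal_powr [measurable]:
  "(\<lambda>x. ennreal_powr x a) \<in> borel_measurable borel"
  unfolding ennreal_powr_def by measurable

text \<open>The two bounds are those on the kernel that the interpolation argument needs: \<open>duration\<close>
  controls the total mass deposited by a particle, and \<open>volume\<close> controls the density that Lebesgue
  measure produces.\<close>

locale flow_kernel =
  fixes W :: "('a::euclidean_space \<times> real) set" and \<psi> :: "'a \<times> real \<Rightarrow> 'a"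
    and \<Omega> :: "'a set" and D B :: real
  assumes W_sets[measurable]: "W \<in> sets (borel \<Otimes>\<^sub>M borel)"
    and \<psi>_measurable[measurable]: "\<psi> \<in> borel \<Otimes>\<^sub>M borel \<rightarrow>\<^sub>M borel"
    and \<Omega>_sets[measurable]: "\<Omega> \<in> sets borel" and \<Omega>_finite: "emeasure lborel \<Omega> < \<infinity>"
    and start_in: "\<And>x s. (x, s) \<in> W \<Longrightarrow> x \<in> \<Omega>"
    and stay_in: "\<And>x s. (x, s) \<in> W \<Longrightarrow> \<psi> (x, s) \<in> \<Omega>"
    and duration: "\<And>x. (\<integral>\<^sup>+s. indicator W (x, s) \<partial>lborel) \<le> ennreal D"
    and volume: "\<And>A. A \<in> sets borel \<Longrightarrow> emeasure (flow_push W \<psi> lborel) A \<le> ennreal B * emeasure lborel A"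
    and B_pos: "B > 0" and D_le: "0 \<le> D" "D \<le> B"
begin

text \<open>The adjoint of the flow: the integral of \<open>\<phi>\<close> along the trajectory of \<open>x\<close>.\<close>

definition occupation :: "('a \<Rightarrow> ennreal) \<Rightarrow> 'a \<Rightarrow> ennreal" where
  "occupation \<phi> x = (\<integral>\<^sup>+s. indicator W (x, s) * \<phi> (\<psi> (x, s)) \<partial>lborel)"

lemma measurable_occupation [measurable]:
  assumes [measurable]: "\<phi> \<in> borel_measurable borel"
  shows "occupation \<phi> \<in> borel_measurable borel"
  unfolding occupation_def by measurable

lemma nn_integral_push:
  assumes "sets \<mu> = sets borel" "\<phi> \<in> borel_measurable borel"
  shows "(\<integral>\<^sup>+z. \<phi> z \<partial>flow_push W \<psi> \<mu>) = (\<integral>\<^sup>+x. occupation \<phi> x \<partial>\<mu>)"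
  unfolding occupation_def using assms by (intro nn_integral_flow_push) auto

lemma emeasure_push:
  assumes "sets \<mu> = sets borel" "A \<in> sets borel"
  shows "emeasure (flow_push W \<psi> \<mu>) A = (\<integral>\<^sup>+x. occupation (indicator A) x \<partial>\<mu>)"
  using nn_integral_push[OF assms(1), of "indicator A"] assms(2) by simp

lemma nn_integral_occupation_le:
  assumes [measurable]: "\<phi> \<in> borel_measurable borel"
  shows "(\<integral>\<^sup>+x. occupation \<phi> x \<partial>lborel) \<le> ennreal B * (\<integral>\<^sup>+x. \<phi> x \<partial>lborel)"
proof -
  have "flow_push W \<psi> lborel \<le> density lborel (\<lambda>_. ennreal B)"
    by (subst le_measure) (auto simp: emeasure_density_const volume)
  hence "(\<integral>\<^sup>+x. \<phi> x \<partial>flow_push W \<psi> lborel) \<le> (\<integral>\<^sup>+x. \<phi> x \<partial>density lborel (\<lambda>_. ennreal B))"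
    by (intro nn_integral_mono_measure) auto
  thus ?thesis by (simp add: nn_integral_push nn_integral_density nn_integral_cmult)
qed

lemma occupation_outside: "x \<notin> \<Omega> \<Longrightarrow> occupation \<phi> x = 0"
proof -
  assume "x \<notin> \<Omega>"
  hence "indicator W (x, s) = (0 :: ennreal)" for s using start_in by (auto simp: indicator_def)
  thus ?thesis by (simp add: occupation_def)
qed

lemma occupation_const_le: "occupation (\<lambda>_. c) x \<le> ennreal D * c * indicator \<Omega> x"
proof (cases "x \<in> \<Omega>")
  case True
  have "occupation (\<lambda>_. c) x = (\<integral>\<^sup>+s. indicator W (x, s) \<partial>lborel) * c"
    unfolding occupation_def by (rule nn_integral_multc) measurable
  also have "\<dots> \<le> ennreal D * c" by (intro mult_right_mono duration) simp
  finally show ?thesis using True by simp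
qed (simp add: occupation_outside)

context
  fixes f :: "'a measure"
  assumes f: "ac_measure_on \<Omega> f"
begin

lemma sets_f: "sets f = sets borel"
  using f by (simp add: ac_measure_on_def)

lemma density_f: "density lborel (RN_deriv lborel f) = f"
  using f by (intro sigma_finite_measure.density_RN_deriv[OF sigma_finite_lborel]) (auto simp: ac_measure_on_def)

lemma nn_integral_f:
  assumes [measurable]: "\<phi> \<in> borel_measurable borel"
  shows "(\<integral>\<^sup>+x. \<phi> x \<partial>f) = (\<integral>\<^sup>+x. RN_deriv lborel f x * \<phi> x \<partial>lborel)"
proof -
  have "(\<integral>\<^sup>+x. \<phi> x \<partial>density lborel (RN_deriv lborel f)) = (\<integral>\<^sup>+x. RN_deriv lborel f x * \<phi> x \<partial>lborel)"
    by (rule nn_integral_density) measurable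
  thus ?thesis by (simp only: density_f)
qed

lemma ac_push: "ac_measure_on \<Omega> (flow_push W \<psi> f)"
proof -
  have fin: "finite_measure f" and ac: "absolutely_continuous lborel f"
    using f by (auto simp: ac_measure_on_def)
  have "emeasure (flow_push W \<psi> f) UNIV = (\<integral>\<^sup>+x. occupation (\<lambda>_. 1) x \<partial>f)"
    by (subst emeasure_push[OF sets_f]) (auto simp: indicator_def)
  also have "\<dots> \<le> (\<integral>\<^sup>+x. ennreal D \<partial>f)"
  proof (rule nn_integral_mono)
    fix x
    show "occupation (\<lambda>_. 1) x \<le> ennreal D"
      using occupation_const_le[of 1 x] by (cases "x \<in> \<Omega>") auto
  qed
  also have "\<dots> < \<infinity>"
    using finite_measure.emeasure_finite[OF fin] by (simp add: ennreal_mult_less_top less_top)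
  finally have "finite_measure (flow_push W \<psi> f)" by (intro finite_measureI) auto
  moreover have "absolutely_continuous lborel (flow_push W \<psi> f)"
    unfolding absolutely_continuous_def
  proof
    fix A :: "'a set" assume A: "A \<in> null_sets lborel"
    hence A'[measurable]: "A \<in> sets borel" by auto
    have "(\<integral>\<^sup>+x. occupation (indicator A) x \<partial>lborel) \<le> 0"
      using nn_integral_occupation_le[of "indicator A"] A by auto
    hence "AE x in lborel. occupation (indicator A) x = 0"
      by (subst nn_integral_0_iff_AE[symmetric]) auto
    hence "AE x in f. occupation (indicator A) x = 0"
      using absolutely_continuous_AE[OF _ ac] by (simp add: sets_f)
    hence "emeasure (flow_push W \<psi> f) A = 0"
      unfolding emeasure_push[OF sets_f A']
      by (subst nn_integral_0_iff_AE) (auto simp: measurable_cong_sets[OF sets_f refl])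
    thus "A \<in> null_sets (flow_push W \<psi> f)" by (intro null_setsI) auto
  qed
  moreover have "emeasure (flow_push W \<psi> f) (- \<Omega>) = 0"
  proof -
    have "indicator W (x, s) * indicator (- \<Omega>) (\<psi> (x, s)) = (0 :: ennreal)" for x s
      using stay_in by (auto simp: indicator_def)
    hence "occupation (indicator (- \<Omega>)) x = 0" for x unfolding occupation_def by (simp only: nn_integral_const mult_zero_left)
    hence "occupation (indicator (- \<Omega>)) = (\<lambda>_. 0)" by (rule ext)
    thus ?thesis by (subst emeasure_push[OF sets_f]) auto
  qed
  ultimately show ?thesis by (simp add: ac_measure_on_def)
qed

lemma nn_integral_RN_push:
  assumes [measurable]: "\<phi> \<in> borel_measurable borel"
  shows "(\<integral>\<^sup>+z. RN_deriv lborel (flow_push W \<psi> f) z * \<phi> z \<partial>lborel) =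
           (\<integral>\<^sup>+x. RN_deriv lborel f x * occupation \<phi> x \<partial>lborel)"
proof -
  let ?\<sigma> = "flow_push W \<psi> f"
  have "density lborel (RN_deriv lborel ?\<sigma>) = ?\<sigma>"
    using ac_push by (intro sigma_finite_measure.density_RN_deriv[OF sigma_finite_lborel]) (auto simp: ac_measure_on_def)
  moreover have "(\<integral>\<^sup>+z. \<phi> z \<partial>density lborel (RN_deriv lborel ?\<sigma>)) = (\<integral>\<^sup>+z. RN_deriv lborel ?\<sigma> z * \<phi> z \<partial>lborel)"
    by (rule nn_integral_density) measurable
  ultimately have "(\<integral>\<^sup>+z. RN_deriv lborel ?\<sigma> z * \<phi> z \<partial>lborel) = (\<integral>\<^sup>+z. \<phi> z \<partial>?\<sigma>)" by simp
  also have "\<dots> = (\<integral>\<^sup>+x. occupation \<phi> x \<partial>f)" by (rule nn_integral_push[OF sets_f]) simp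
  also have "\<dots> = (\<integral>\<^sup>+x. RN_deriv lborel f x * occupation \<phi> x \<partial>lborel)"
    by (rule nn_integral_f) measurable
  finally show ?thesis .
qed

lemma RN_finite:
  "AE x in lborel. RN_deriv lborel f x \<noteq> \<infinity>"
  "AE x in lborel. RN_deriv lborel (flow_push W \<psi> f) x \<noteq> \<infinity>"
proof -
  have "AE x in lborel. RN_deriv lborel \<mu> x \<noteq> \<infinity>" if "ac_measure_on \<Omega> \<mu>" for \<mu>
    by (rule sigma_finite_measure.RN_deriv_finite[OF sigma_finite_lborel])
      (use that in \<open>auto simp: ac_measure_on_def finite_measure_def\<close>)
  from this[OF f] this[OF ac_push] show
    "AE x in lborel. RN_deriv lborel f x \<noteq> \<infinity>"
    "AE x in lborel. RN_deriv lborel (flow_push W \<psi> f) x \<noteq> \<infinity>" .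
qed

text \<open>A density bounded by \<open>c\<close> on \<open>\<Omega>\<close> gives an image below \<open>c\<close> times the image of Lebesgue measure.\<close>

lemma Lp_norm_infinity_push_le:
  "Lp_norm \<infinity> \<Omega> (flow_push W \<psi> f) \<le> ennreal B * Lp_norm \<infinity> \<Omega> f"
proof -
  define h where "h = RN_deriv lborel f"
  define g where "g = RN_deriv lborel (flow_push W \<psi> f)"
  have [measurable]: "h \<in> borel_measurable borel" "g \<in> borel_measurable borel"
    using borel_measurable_RN_deriv[of lborel] by (auto simp: h_def g_def)
  define c where "c = esssup (restrict_space lborel \<Omega>) h"
  have norm: "Lp_norm \<infinity> \<Omega> f = c" "Lp_norm \<infinity> \<Omega> (flow_push W \<psi> f) = esssup (restrict_space lborel \<Omega>) g"
    by (simp_all add: Lp_norm_def Lp_norm_fun_def c_def h_def g_def)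
  have restr: "(AE x in restrict_space lborel \<Omega>. P x) \<longleftrightarrow> (AE x in lborel. x \<in> \<Omega> \<longrightarrow> P x)" for P
    by (rule AE_restrict_space_iff) simp
  have hc: "AE x in lborel. x \<in> \<Omega> \<longrightarrow> h x \<le> c"
    unfolding restr[symmetric] c_def by (rule esssup_AE)
  show ?thesis
  proof (cases "c = \<infinity>")
    case True
    thus ?thesis unfolding norm using B_pos by (simp add: ennreal_mult_top)
  next
    case False
    have "AE x in lborel. x \<in> \<Omega> \<longrightarrow> g x \<le> ennreal B * c"
    proof (rule AE_le_if_emeasure_density_le[OF _ \<Omega>_sets \<Omega>_finite])
      show "ennreal B * c < \<infinity>" using False by (simp add: ennreal_mult_less_top less_top)
      fix A :: "'a set" assume [measurable]: "A \<in> sets borel"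
      have "(\<integral>\<^sup>+x. g x * indicator A x \<partial>lborel) = (\<integral>\<^sup>+x. h x * occupation (indicator A) x \<partial>lborel)"
        unfolding g_def h_def by (rule nn_integral_RN_push) simp
      also have "\<dots> \<le> (\<integral>\<^sup>+x. c * occupation (indicator A) x \<partial>lborel)"
      proof (rule nn_integral_mono_AE, use hc in eventually_elim)
        fix x assume "x \<in> \<Omega> \<longrightarrow> h x \<le> c"
        thus "h x * occupation (indicator A) x \<le> c * occupation (indicator A) x"
          by (cases "x \<in> \<Omega>") (auto simp: occupation_outside intro: mult_right_mono)
      qed
      also have "\<dots> = c * (\<integral>\<^sup>+x. occupation (indicator A) x \<partial>lborel)"
        by (rule nn_integral_cmult) measurable
      also have "\<dots> \<le> c * (ennreal B * (\<integral>\<^sup>+x. indicator A x \<partial>lborel))"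
        by (intro mult_left_mono nn_integral_occupation_le) auto
      finally show "(\<integral>\<^sup>+x. g x * indicator A x \<partial>lborel) \<le> ennreal B * c * emeasure lborel A"
        by (simp add: mult_ac)
    qed measurable
    thus ?thesis unfolding norm restr[symmetric]
      by (intro esssup_I measurable_restrict_space1) auto
  qed
qed

text \<open>With \<open>b\<close> the truncation of the density \<open>g\<close> of the image and \<open>I\<close> the integral of \<open>b powr p\<close>, one has
  \<open>I \<le> \<integral> g * b powr (p - 1)\<close>. By duality this is an integral of \<open>h\<close> against the occupation integrals
  of \<open>b powr (p - 1)\<close>, and \<open>Young_powr\<close> bounds it by \<open>(1 - 1 / p) * I\<close> plus a multiple of the
  integral of \<open>h powr p\<close>. The truncation makes \<open>I\<close> finite, so the first term can be absorbed.\<close>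

lemma truncated_power_push_le:
  fixes p :: real and n :: nat
  assumes p: "p \<ge> 1"
  defines "h \<equiv> RN_deriv lborel f" and "g \<equiv> RN_deriv lborel (flow_push W \<psi> f)"
  defines "b \<equiv> \<lambda>z. min (enn2real (g z)) (real n) * indicator \<Omega> z"
  shows "(\<integral>\<^sup>+z. ennreal (b z powr p) \<partial>lborel) \<le>
           ennreal (B powr p) * (\<integral>\<^sup>+x\<in>\<Omega>. ennreal_powr (h x) p \<partial>lborel)"
proof -
  have [measurable]: "h \<in> borel_measurable borel" "g \<in> borel_measurable borel"
    using borel_measurable_RN_deriv[of lborel] by (auto simp: h_def g_def)
  have [measurable]: "b \<in> borel_measurable borel" unfolding b_def by measurable
  have b_nn: "b z \<ge> 0" for z by (simp add: b_def)
  define I where "I = (\<integral>\<^sup>+z. ennreal (b z powr p) \<partial>lborel)"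
  define H where "H = (\<integral>\<^sup>+x\<in>\<Omega>. ennreal_powr (h x) p \<partial>lborel)"
  define c1 where "c1 = (1 - 1 / p) / B"
  define c2 where "c2 = B powr (p - 1) / p"
  have c: "c1 \<ge> 0" "c2 \<ge> 0" using p B_pos by (auto simp: c1_def c2_def)
  have "I \<le> (\<integral>\<^sup>+z. ennreal (real n powr p) * indicator \<Omega> z \<partial>lborel)"
    unfolding I_def b_def using p
    by (intro nn_integral_mono) (auto simp: indicator_def intro!: ennreal_leI powr_mono2)
  also have "\<dots> = ennreal (real n powr p) * emeasure lborel \<Omega>"
    by (rule nn_integral_cmult_indicator) simp
  also have "\<dots> < \<infinity>" using \<Omega>_finite by (simp add: ennreal_mult_less_top)
  finally have I_fin: "I < \<infinity>" .
  have "ennreal (b z powr p) \<le> g z * ennreal (b z powr (p - 1))" for z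
  proof (cases "g z")
    case top
    thus ?thesis by (simp add: b_def)
  next
    case (real \<gamma>)
    have "b z powr p \<le> \<gamma> * b z powr (p - 1)"
    proof (cases "b z = 0")
      case False
      hence "b z > 0" using b_nn[of z] by simp
      hence "b z powr p = b z * b z powr (p - 1)" by (simp add: powr_mult_base)
      also have "\<dots> \<le> \<gamma> * b z powr (p - 1)"
        using real by (intro mult_right_mono) (auto simp: b_def indicator_def)
      finally show ?thesis .
    qed (use real in simp)
    thus ?thesis using real by (simp add: ennreal_mult'[symmetric] ennreal_leI)
  qed
  hence "I \<le> (\<integral>\<^sup>+z. g z * ennreal (b z powr (p - 1)) \<partial>lborel)"
    unfolding I_def by (intro nn_integral_mono)
  also have "\<dots> = (\<integral>\<^sup>+x. h x * occupation (\<lambda>z. ennreal (b z powr (p - 1))) x \<partial>lborel)"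
    unfolding g_def h_def by (rule nn_integral_RN_push) measurable
  also have "\<dots> \<le> (\<integral>\<^sup>+x. ennreal c1 * occupation (\<lambda>z. ennreal (b z powr p)) x +
      ennreal c2 * (ennreal D * (ennreal_powr (h x) p * indicator \<Omega> x)) \<partial>lborel)"
  proof (rule nn_integral_mono_AE, use RN_finite(1) in eventually_elim)
    fix x assume "RN_deriv lborel f x \<noteq> \<infinity>"
    then obtain \<eta> where \<eta>: "h x = ennreal \<eta>" "\<eta> \<ge> 0" by (cases "h x") (auto simp: h_def)
    have "h x * occupation (\<lambda>z. ennreal (b z powr (p - 1))) x =
        (\<integral>\<^sup>+s. h x * (indicator W (x, s) * ennreal (b (\<psi> (x, s)) powr (p - 1))) \<partial>lborel)"
      unfolding occupation_def by (rule nn_integral_cmult[symmetric]) measurable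
    also have "\<dots> \<le> (\<integral>\<^sup>+s. ennreal c1 * (indicator W (x, s) * ennreal (b (\<psi> (x, s)) powr p)) +
        ennreal c2 * (indicator W (x, s) * ennreal (\<eta> powr p)) \<partial>lborel)"
    proof (rule nn_integral_mono)
      fix s
      define \<beta> where "\<beta> = b (\<psi> (x, s))"
      have "\<eta> * \<beta> powr (p - 1) \<le> c1 * \<beta> powr p + c2 * \<eta> powr p"
        unfolding c1_def c2_def \<beta>_def by (rule Young_powr[OF p B_pos b_nn \<eta>(2)])
      hence "ennreal (\<eta> * \<beta> powr (p - 1)) \<le> ennreal (c1 * \<beta> powr p + c2 * \<eta> powr p)"
        by (rule ennreal_leI)
      hence "ennreal \<eta> * ennreal (b (\<psi> (x, s)) powr (p - 1)) \<le>
          ennreal c1 * ennreal (b (\<psi> (x, s)) powr p) + ennreal c2 * ennreal (\<eta> powr p)"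
        using c \<eta>(2) unfolding \<beta>_def by (simp add: ennreal_mult')
      thus "h x * (indicator W (x, s) * ennreal (b (\<psi> (x, s)) powr (p - 1))) \<le>
          ennreal c1 * (indicator W (x, s) * ennreal (b (\<psi> (x, s)) powr p)) +
          ennreal c2 * (indicator W (x, s) * ennreal (\<eta> powr p))"
        by (simp add: \<eta> indicator_def)
    qed
    also have "\<dots> = ennreal c1 * occupation (\<lambda>z. ennreal (b z powr p)) x +
        ennreal c2 * occupation (\<lambda>_. ennreal (\<eta> powr p)) x"
      unfolding occupation_def by (subst nn_integral_add) (auto simp: nn_integral_cmult)
    also have "\<dots> \<le> ennreal c1 * occupation (\<lambda>z. ennreal (b z powr p)) x +
        ennreal c2 * (ennreal D * (ennreal_powr (h x) p * indicator \<Omega> x))"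
      using occupation_const_le[of "ennreal (\<eta> powr p)" x] \<eta>
      by (intro add_left_mono mult_left_mono) (auto simp: ennreal_powr_def mult.assoc)
    finally show "h x * occupation (\<lambda>z. ennreal (b z powr (p - 1))) x \<le>
        ennreal c1 * occupation (\<lambda>z. ennreal (b z powr p)) x +
        ennreal c2 * (ennreal D * (ennreal_powr (h x) p * indicator \<Omega> x))" .
  qed
  also have "\<dots> = ennreal c1 * (\<integral>\<^sup>+x. occupation (\<lambda>z. ennreal (b z powr p)) x \<partial>lborel) +
      ennreal c2 * (ennreal D * H)"
    unfolding H_def by (subst nn_integral_add) (auto simp: nn_integral_cmult)
  also have "\<dots> \<le> ennreal c1 * (ennreal B * I) + ennreal c2 * (ennreal D * H)"
    unfolding I_def by (intro add_right_mono mult_left_mono nn_integral_occupation_le) auto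
  finally have absorb: "I \<le> ennreal c1 * (ennreal B * I) + ennreal c2 * (ennreal D * H)" .
  have "I \<le> ennreal (B powr p) * H"
  proof (cases H)
    case top
    thus ?thesis using B_pos by (simp add: ennreal_mult_top)
  next
    case (real h')
    obtain i where i: "I = ennreal i" "i \<ge> 0" using I_fin by (cases I) auto
    have "ennreal i \<le> ennreal (c1 * (B * i) + c2 * (D * h'))"
      using absorb c B_pos D_le real i
      by (simp add: ennreal_mult'[symmetric] ennreal_plus[symmetric] del: ennreal_plus)
    hence "i \<le> c1 * (B * i) + c2 * (D * h')"
      using c B_pos D_le real i by (subst (asm) ennreal_le_iff) auto
    also have "c1 * (B * i) = (1 - 1 / p) * i" using B_pos by (simp add: c1_def)
    finally have "i / p \<le> B powr (p - 1) * (D * h') / p"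
      by (simp add: c2_def algebra_simps)
    hence "i \<le> B powr (p - 1) * (D * h')" using p by (simp add: divide_le_cancel)
    also have "\<dots> \<le> B powr (p - 1) * (B * h')"
      using D_le real by (intro mult_left_mono mult_right_mono) auto
    also have "\<dots> = B powr p * h'" using powr_mult_base[of B "p - 1"] B_pos by (simp add: mult_ac)
    finally show ?thesis using i real by (simp add: ennreal_mult'[symmetric] ennreal_leI)
  qed
  thus ?thesis by (simp add: I_def H_def)
qed

text \<open>Monotone convergence removes the truncation.\<close>

lemma Lp_norm_finite_push_le:
  assumes p: "1 \<le> p" "p \<noteq> \<infinity>"
  shows "Lp_norm p \<Omega> (flow_push W \<psi> f) \<le> ennreal B * Lp_norm p \<Omega> f"
proof -
  define q where "q = enn2real p"
  have q: "q \<ge> 1" using p by (cases p) (auto simp: q_def)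
  define h where "h = RN_deriv lborel f"
  define g where "g = RN_deriv lborel (flow_push W \<psi> f)"
  have [measurable]: "g \<in> borel_measurable borel"
    using borel_measurable_RN_deriv[of lborel] by (auto simp: g_def)
  define b where "b n z = min (enn2real (g z)) (real n) * indicator \<Omega> z" for n z
  have [measurable]: "b n \<in> borel_measurable borel" for n unfolding b_def by measurable
  have mono: "b m z \<le> b n z" if "m \<le> n" for m n z
    using that by (auto simp: b_def indicator_def)
  have inc: "incseq (\<lambda>n z. ennreal (b n z powr q))"
    using mono q by (auto simp: incseq_def le_fun_def b_def intro!: ennreal_leI powr_mono2)
  have "(\<integral>\<^sup>+z\<in>\<Omega>. ennreal_powr (g z) q \<partial>lborel) = (\<integral>\<^sup>+z. (SUP n. ennreal (b n z powr q)) \<partial>lborel)"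
  proof (rule nn_integral_cong_AE, use RN_finite(2) in eventually_elim)
    fix z assume "RN_deriv lborel (flow_push W \<psi> f) z \<noteq> \<infinity>"
    hence gz: "g z \<noteq> \<infinity>" by (simp add: g_def)
    obtain n :: nat where n: "enn2real (g z) \<le> real n" using real_arch_simple by blast
    have top: "ennreal_powr (g z) q * indicator \<Omega> z = ennreal ((enn2real (g z) * indicator \<Omega> z) powr q)"
      using gz q by (auto simp: ennreal_powr_def indicator_def)
    show "ennreal_powr (g z) q * indicator \<Omega> z = (SUP n. ennreal (b n z powr q))"
    proof (rule antisym)
      have "ennreal_powr (g z) q * indicator \<Omega> z = ennreal (b n z powr q)"
        unfolding top using n by (simp add: b_def min_absorb1)
      thus "ennreal_powr (g z) q * indicator \<Omega> z \<le> (SUP n. ennreal (b n z powr q))"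
        by (auto intro: SUP_upper)
      show "(SUP n. ennreal (b n z powr q)) \<le> ennreal_powr (g z) q * indicator \<Omega> z"
        unfolding top using q
        by (intro SUP_least ennreal_leI powr_mono2) (auto simp: b_def indicator_def)
    qed
  qed
  also have "\<dots> = (SUP n. \<integral>\<^sup>+z. ennreal (b n z powr q) \<partial>lborel)"
    by (rule nn_integral_monotone_convergence_SUP[OF inc]) measurable
  also have "\<dots> \<le> ennreal (B powr q) * (\<integral>\<^sup>+x\<in>\<Omega>. ennreal_powr (h x) q \<partial>lborel)"
    unfolding b_def g_def h_def by (intro SUP_least truncated_power_push_le q)
  finally show ?thesis
    using p unfolding Lp_norm_def Lp_norm_fun_def g_def h_def q_def[symmetric]
    by (simp add: ennreal_powr_mono_scaled[OF q B_pos])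
qed

lemma Lp_norm_push_le:
  assumes "1 \<le> p"
  shows "Lp_norm p \<Omega> (flow_push W \<psi> f) \<le> ennreal B * Lp_norm p \<Omega> f"
  using Lp_norm_infinity_push_le Lp_norm_finite_push_le[OF assms] by (cases "p = \<infinity>") auto

end

end

text \<open>The volume factor is at least 1, which makes the same constant dominate both the duration and the
  density bound.\<close>

lemma ray_flow_kernel:
  fixes \<Omega> :: "'a::euclidean_space set"
  assumes \<Omega>: "bounded_domain \<Omega>" and ext: "exterior_ball_condition r \<Omega>" and r: "r > 0"
    and D: "diameter \<Omega> \<le> D" "D > 0"
  shows "flow_kernel (ray_region \<Omega>) (ray_flow (frontier \<Omega>)) \<Omega> D
           (D * (2 * (2 + 2 * D / r) * DIM('a)) ^ DIM('a))"
proof -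
  note F = bounded_domain_frontier[OF \<Omega>]
  define K where "K = (2 * (2 + 2 * D / r) * DIM('a)) ^ DIM('a)"
  have "1 \<le> 2 * (2 + 2 * D / r) * real DIM('a)"
  proof -
    have "1 * 1 \<le> (2 * (2 + 2 * D / r)) * real DIM('a)"
      using D r DIM_positive[where 'a='a] by (intro mult_mono) (auto simp: Suc_le_eq)
    thus ?thesis by simp
  qed
  hence K: "1 \<le> K" unfolding K_def by (rule one_le_power)
  have "flow_kernel (ray_region \<Omega>) (ray_flow (frontier \<Omega>)) \<Omega> D (D * K)"
  proof
    show "emeasure lborel \<Omega> < \<infinity>" using \<Omega> by (intro emeasure_bounded_finite) (simp add: bounded_domain_def)
    show "(\<integral>\<^sup>+s. indicator (ray_region \<Omega>) (x, s) \<partial>lborel) \<le> ennreal D" for x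
    proof -
      have "(\<integral>\<^sup>+s. indicator (ray_region \<Omega>) (x, s) \<partial>lborel) \<le> (\<integral>\<^sup>+s. indicator {0..D} s \<partial>lborel)"
      proof (intro nn_integral_mono)
        fix s :: real
        show "indicator (ray_region \<Omega>) (x, s) \<le> (indicator {0..D} s :: ennreal)"
          using ray_regionD(4,6)[OF \<Omega>, of x s] D(1) by (auto simp: indicator_def)
      qed
      thus ?thesis using D by simp
    qed
    show "emeasure (flow_push (ray_region \<Omega>) (ray_flow (frontier \<Omega>)) lborel) A
        \<le> ennreal (D * K) * emeasure lborel A" if "A \<in> sets borel" for A
      using ray_transport_lborel_le[OF \<Omega> ext r D that] by (simp add: ray_transport_def K_def)
    show "D \<le> D * K" "0 < D * K" using D K by auto
  qed (use D F measurable_ray_region[OF \<Omega>] measurable_ray_flow ray_regionD[OF \<Omega>] in auto)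
  thus ?thesis by (simp add: K_def)
qed

theorem theorem3p5:
  fixes r L :: real
  assumes "r > 0"
  shows "\<exists>C\<ge>0. \<forall>(\<Omega> :: 'a::euclidean_space set) (p :: ennreal) (f :: 'a measure).
           bounded_domain \<Omega> \<longrightarrow> exterior_ball_condition r \<Omega> \<longrightarrow> diameter \<Omega> = L \<longrightarrow>
           1 \<le> p \<longrightarrow> ac_measure_on \<Omega> f \<longrightarrow> in_Lp p \<Omega> f \<longrightarrow>
           (let \<sigma> = transport_density f (boundary_projection_image \<Omega> f) in
              in_Lp p \<Omega> \<sigma> \<and> Lp_norm p \<Omega> \<sigma> \<le> ennreal C * Lp_norm p \<Omega> f)"
proof -
  \<comment> \<open>Any positive upper bound for the diameter will do; this one is positive also when \<open>L\<close> is not.\<close>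
  define D where "D = \<bar>L\<bar> + 1"
  define C where "C = D * (2 * (2 + 2 * D / r) * DIM('a)) ^ DIM('a)"
  have "D > 0" by (simp add: D_def)
  hence "C \<ge> 0" using assms by (simp add: C_def)
  moreover have "in_Lp p \<Omega> \<sigma> \<and> Lp_norm p \<Omega> \<sigma> \<le> ennreal C * Lp_norm p \<Omega> f"
    if \<Omega>: "bounded_domain \<Omega>" "exterior_ball_condition r \<Omega>" "diameter \<Omega> = L"
      and p: "1 \<le> p" and f: "ac_measure_on \<Omega> f" "in_Lp p \<Omega> f"
      and \<sigma>: "\<sigma> = transport_density f (boundary_projection_image \<Omega> f)"
    for \<Omega> :: "'a set" and p f \<sigma>
  proof -
    interpret ray: flow_kernel "ray_region \<Omega>" "ray_flow (frontier \<Omega>)" \<Omega> D C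
      unfolding C_def by (rule ray_flow_kernel[OF \<Omega>(1,2) assms]) (use \<Omega>(3) in \<open>auto simp: D_def\<close>)
    have eq: "\<sigma> = flow_push (ray_region \<Omega>) (ray_flow (frontier \<Omega>)) f"
      unfolding \<sigma> transport_density_eq_ray_transport[OF \<Omega>(1) f(1)] by (simp add: ray_transport_def)
    have le: "Lp_norm p \<Omega> \<sigma> \<le> ennreal C * Lp_norm p \<Omega> f"
      unfolding eq by (rule ray.Lp_norm_push_le[OF f(1) p])
    also have "\<dots> < \<infinity>" using f(2) by (simp add: in_Lp_def ennreal_mult_less_top)
    finally show ?thesis using le ray.ac_push[OF f(1)] by (simp add: in_Lp_def eq)
  qed
  ultimately show ?thesis unfolding Let_def by blast
qed

end
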